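(* Fix $\lambda>1$, and let $q:S^1\to(0,\infty)$ be a smooth function satisfying $$q(t)+q\left(t+\tfrac12\right)=\frac{2}{\kappa_\lambda}\qquad\text{for every }t\in S^1 .$$ Then the metric $$g_{\lambda,q}=q(t)^2\,dt^2+h_\lambda(t)$$ on $\mathbb{T}^3=\mathbb{T}^2\times S^1$ is nonflat and satisfies $$\|r_{a,b,c}\|_{\mathrm{st},g_{\lambda,q}}=\sqrt{a^2+b^2+c^2}$$ for every $(a,b,c)\in\mathbb{R}^3\cong H_2(\mathbb{T}^3,\mathbb{R})$. Moreover, $$\operatorname{Vol}(\mathbb{T}^3,g_{\lambda,q})=\kappa_\lambda^{-1}.$$
   Context: $\mathbb{T}^3=\mathbb{R}^3/\mathbb{Z}^3=\mathbb{T}^2_{(x,y)}\times S^1_t$ with $S^1=\mathbb{R}/\mathbb{Z}$, oriented by $dx\wedge dy\wedge dt$. For $(a,b,c)\in\mathbb{R}^3$, $r_{a,b,c}\in H_2(\mathbb{T}^3,\mathbb{R})$ is the class whose Poincar\'e dual is $a[dx]+b[dy]+c[dt]$. For $\lambda>0$ let $D_\lambda=\operatorname{diag}(\lambda^2,\lambda^{-2})$, let $R_\theta$ be the $2\times2$ rotation matrix by angle $\theta$, and let $$h_\lambda(t)=R_{2\pi t}^T D_\lambda R_{2\pi t},$$ regarded, for each $t$, as the constant-coefficient metric on $\mathbb{T}^2$ with this matrix in the coordinates $(x,y)$. Set $$\kappa_\lambda=\int_0^1\sqrt{\lambda^{-2}\cos^2(2\pi t)+\lambda^2\sin^2(2\pi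 t)}\,dt .$$ Stable norm: for $r\in H_2(\mathbb{T}^3,\mathbb{R})$, $\|r\|_{\mathrm{st},g}:=\inf\{\mathbf{M}_g(T): T \text{ a closed real } 2\text{-current with } [T]=r\}$, where $\mathbf{M}_g$ is mass (equivalently, one may use real Lipschitz cycles). *)

theory Defs
  imports "HOL-Analysis.Analysis"
begin

section \<open>Smooth functions and tensor fields on the torus\<close>

text \<open>
  The torus is R^3 / Z^3. Functions, forms and metrics on it are represented by their
  Z^3-periodic lifts to R^3, and the tangent space at every point is identified with
  \<^typ>\<open>real^3\<close>; the coordinates 1, 2, 3 are x, y, t.
\<close>

definition dirderiv :: "'a::real_normed_vector \<Rightarrow> ('a \<Rightarrow> 'b::real_normed_vector) \<Rightarrow> 'a \<Rightarrow> 'b" where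
  "dirderiv v f x = frechet_derivative f (at x) v"

abbreviation dirderivs :: "'a::real_normed_vector list \<Rightarrow> ('a \<Rightarrow> 'b::real_normed_vector) \<Rightarrow> 'a \<Rightarrow> 'b" where
  "dirderivs vs f \<equiv> fold dirderiv vs f"

text \<open>Smoothness: iterated directional derivatives of all orders exist and are
  (Frechet) differentiable.\<close>

definition smooth :: "('a::real_normed_vector \<Rightarrow> 'b::real_normed_vector) \<Rightarrow> bool" where
  "smooth f \<longleftrightarrow> (\<forall>vs x. dirderivs vs f differentiable (at x))"

abbreviation ax :: "3 \<Rightarrow> real^3" where
  "ax i \<equiv> axis i 1"

definition periodic3 :: "(real^3 \<Rightarrow> 'b) \<Rightarrow> bool" where
  "periodic3 f \<longleftrightarrow> (\<forall>p i. f (p + ax i) = f p)"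

definition torus_integral :: "(real^3 \<Rightarrow> real) \<Rightarrow> real" where
  "torus_integral f = integral (cbox 0 1) f"


section \<open>Differential forms\<close>

text \<open>
  A differential k-form takes a point and a list of k tangent vectors. It is set to 0 on lists
  of any other length, so that the representation is unique.
\<close>

type_synonym form = "real^3 \<Rightarrow> (real^3) list \<Rightarrow> real"

definition forms :: "nat \<Rightarrow> form set" where
  "forms k = {\<omega>.
     (\<forall>p vs. length vs \<noteq> k \<longrightarrow> \<omega> p vs = 0) \<and>
     (\<forall>p vs i. length vs = k \<and> i < k \<longrightarrow> linear (\<lambda>v. \<omega> p (vs[i := v]))) \<and>
     (\<forall>p vs i j. length vs = k \<and> i < j \<and> j < k \<and> vs ! i = vs ! j \<longrightarrow> \<omega> p vs = 0) \<and>
     (\<forall>vs. smooth (\<lambda>p. \<omega> p vs)) \<and>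
     (\<forall>vs. periodic3 (\<lambda>p. \<omega> p vs))}"

definition omit_nth :: "nat \<Rightarrow> 'a list \<Rightarrow> 'a list" where
  "omit_nth i vs = take i vs @ drop (Suc i) vs"

text \<open>The invariant formula for the exterior derivative, evaluated on constant vector fields
  (the bracket terms vanish).\<close>

definition ext_deriv :: "form \<Rightarrow> form" where
  "ext_deriv \<omega> = (\<lambda>p vs. \<Sum>i<length vs. (-1)^i * dirderiv (vs ! i) (\<lambda>p. \<omega> p (omit_nth i vs)) p)"

text \<open>The wedge product of a form (on the left) with a 1-form (on the right), normalised so
  that dx \<open>\<and>\<close> dy takes the value 1 on the first two coordinate vectors.\<close>

definition wedge1 :: "form \<Rightarrow> form \<Rightarrow> form" where
  "wedge1 \<beta> \<alpha> = (\<lambda>p vs. \<Sum>i<length vs.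
     (-1)^(length vs - Suc i) * \<beta> p (omit_nth i vs) * \<alpha> p [vs ! i])"

text \<open>The integral of a 3-form over the torus oriented by dx \<open>\<and>\<close> dy \<open>\<and>\<close> dt.\<close>

definition form_integral :: "form \<Rightarrow> real" where
  "form_integral \<omega> = torus_integral (\<lambda>p. \<omega> p [ax 1, ax 2, ax 3])"

text \<open>The closed 1-form a dx + b dy + c dt.\<close>

definition const_form1 :: "real \<Rightarrow> real \<Rightarrow> real \<Rightarrow> form" where
  "const_form1 a b c = (\<lambda>p vs. case vs of [v] \<Rightarrow> a * v$1 + b * v$2 + c * v$3 | _ \<Rightarrow> 0)"


section \<open>Currents and their real homology\<close>

text \<open>Convergence in the Frechet topology on k-forms: uniform convergence of all derivatives.\<close>

definition forms_converge :: "(nat \<Rightarrow> form) \<Rightarrow> form \<Rightarrow> bool" where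
  "forms_converge \<omega>s \<omega> \<longleftrightarrow> (\<forall>vs us. uniform_limit UNIV
     (\<lambda>n. dirderivs us (\<lambda>p. \<omega>s n p vs)) (dirderivs us (\<lambda>p. \<omega> p vs)) sequentially)"

text \<open>
  A k-current is a continuous linear functional on k-forms. As the space of k-forms is
  metrizable, continuity is sequential continuity. Values outside \<open>forms k\<close> are irrelevant.
\<close>

type_synonym current = "form \<Rightarrow> real"

definition currents :: "nat \<Rightarrow> current set" where
  "currents k = {T.
     (\<forall>\<omega>\<in>forms k. \<forall>\<eta>\<in>forms k. T (\<lambda>p vs. \<omega> p vs + \<eta> p vs) = T \<omega> + T \<eta>) \<and>
     (\<forall>c. \<forall>\<omega>\<in>forms k. T (\<lambda>p vs. c * \<omega> p vs) = c * T \<omega>) \<and>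
     (\<forall>\<omega>s. \<forall>\<omega>\<in>forms k. (\<forall>n. \<omega>s n \<in> forms k) \<and> forms_converge \<omega>s \<omega>
        \<longrightarrow> (\<lambda>n. T (\<omega>s n)) \<longlonglongrightarrow> T \<omega>)}"

definition bdry :: "current \<Rightarrow> current" where
  "bdry T = (\<lambda>\<omega>. T (ext_deriv \<omega>))"

definition closed_currents :: "nat \<Rightarrow> current set" where
  "closed_currents k = {T \<in> currents k. k > 0 \<longrightarrow> (\<forall>\<eta>\<in>forms (k - 1). bdry T \<eta> = 0)}"

definition homologous :: "nat \<Rightarrow> (current \<times> current) set" where
  "homologous k = {(T, T'). T \<in> closed_currents k \<and> T' \<in> closed_currents k \<and>
     (\<exists>S\<in>currents (Suc k). \<forall>\<omega>\<in>forms k. T' \<omega> - T \<omega> = bdry S \<omega>)}"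

definition homology_class :: "nat \<Rightarrow> current \<Rightarrow> current set" where
  "homology_class k T = homologous k `` {T}"

text \<open>
  The 2-dimensional class whose Poincare dual is the de Rham class of a closed 1-form \<open>\<alpha>\<close> is
  represented by the closed current \<open>\<beta> \<mapsto> \<integral> \<beta> \<and> \<alpha>\<close>. As \<open>\<beta>\<close> has even degree, the order of the
  factors does not matter.
\<close>

definition class_with_PD :: "form \<Rightarrow> current set" where
  "class_with_PD \<alpha> = homology_class 2 (\<lambda>\<beta>. form_integral (wedge1 \<beta> \<alpha>))"

definition r_class :: "real \<Rightarrow> real \<Rightarrow> real \<Rightarrow> current set" where
  "r_class a b c = class_with_PD (const_form1 a b c)"


section \<open>Riemannian metrics, mass and stable norm\<close>

text \<open>A metric is given by its Gram matrix in the coordinates (x, y, t).\<close>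

type_synonym metric = "real^3 \<Rightarrow> real^3^3"

definition inner_at :: "metric \<Rightarrow> real^3 \<Rightarrow> real^3 \<Rightarrow> real^3 \<Rightarrow> real" where
  "inner_at g p u v = u \<bullet> (g p *v v)"

definition riemannian_metric :: "metric \<Rightarrow> bool" where
  "riemannian_metric g \<longleftrightarrow>
     (\<forall>i j. smooth (\<lambda>p. g p $ i $ j)) \<and> periodic3 g \<and>
     (\<forall>p. transpose (g p) = g p) \<and> (\<forall>p v. v \<noteq> 0 \<longrightarrow> inner_at g p v v > 0)"

definition riem_volume :: "metric \<Rightarrow> real" where
  "riem_volume g = torus_integral (\<lambda>p. sqrt (det (g p)))"

definition orthonormal_frames :: "metric \<Rightarrow> real^3 \<Rightarrow> nat \<Rightarrow> (real^3) list set" where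
  "orthonormal_frames g p k = {vs. length vs = k \<and>
     (\<forall>i<k. \<forall>j<k. inner_at g p (vs ! i) (vs ! j) = (if i = j then 1 else 0))}"

text \<open>The comass at \<open>p\<close> of a k-covector \<open>\<phi>\<close>: the unit simple k-vectors are the wedge products
  of orthonormal k-frames.\<close>

definition comass :: "metric \<Rightarrow> real^3 \<Rightarrow> nat \<Rightarrow> ((real^3) list \<Rightarrow> real) \<Rightarrow> ereal" where
  "comass g p k \<phi> = (SUP vs\<in>orthonormal_frames g p k. ereal \<bar>\<phi> vs\<bar>)"

definition mass :: "metric \<Rightarrow> nat \<Rightarrow> current \<Rightarrow> ereal" where
  "mass g k T = (SUP \<omega>\<in>{\<omega> \<in> forms k. \<forall>p. comass g p k (\<omega> p) \<le> 1}. ereal (T \<omega>))"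

definition stable_norm :: "metric \<Rightarrow> current set \<Rightarrow> ereal" where
  "stable_norm g r = (INF T\<in>r. mass g 2 T)"


section \<open>Curvature\<close>

definition christoffel :: "metric \<Rightarrow> 3 \<Rightarrow> 3 \<Rightarrow> 3 \<Rightarrow> real^3 \<Rightarrow> real" where
  "christoffel g k i j p = (\<Sum>l\<in>UNIV. matrix_inv (g p) $ k $ l *
     (dirderiv (ax i) (\<lambda>p. g p $ j $ l) p + dirderiv (ax j) (\<lambda>p. g p $ i $ l) p
      - dirderiv (ax l) (\<lambda>p. g p $ i $ j) p)) / 2"

text \<open>The component \<open>R\<^sup>l\<^sub>k\<^sub>i\<^sub>j\<close> of the Riemann tensor of the Levi-Civita connection, i.e. the l-th
  component of \<open>R(\<partial>\<^sub>i, \<partial>\<^sub>j)\<partial>\<^sub>k\<close>.\<close>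

definition riemann_tensor :: "metric \<Rightarrow> 3 \<Rightarrow> 3 \<Rightarrow> 3 \<Rightarrow> 3 \<Rightarrow> real^3 \<Rightarrow> real" where
  "riemann_tensor g l k i j p =
     dirderiv (ax i) (christoffel g l j k) p - dirderiv (ax j) (christoffel g l i k) p
     + (\<Sum>m\<in>UNIV. christoffel g l i m p * christoffel g m j k p
                 - christoffel g l j m p * christoffel g m i k p)"

definition flat :: "metric \<Rightarrow> bool" where
  "flat g \<longleftrightarrow> (\<forall>l k i j p. riemann_tensor g l k i j p = 0)"


section \<open>The metrics of the theorem\<close>

definition diag_mat :: "real \<Rightarrow> real^2^2" where
  "diag_mat lam = vector [vector [lam^2, 0], vector [0, lam powi -2]]"

definition rot_mat :: "real \<Rightarrow> real^2^2" where
  "rot_mat \<theta> = vector [vector [cos \<theta>, - sin \<theta>], vector [sin \<theta>, cos \<theta>]]"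

definition h_metric :: "real \<Rightarrow> real \<Rightarrow> real^2^2" where
  "h_metric lam t = transpose (rot_mat (2 * pi * t)) ** diag_mat lam ** rot_mat (2 * pi * t)"

definition kappa :: "real \<Rightarrow> real" where
  "kappa lam = integral {0..1}
     (\<lambda>t. sqrt (lam powi -2 * (cos (2 * pi * t))^2 + lam^2 * (sin (2 * pi * t))^2))"

definition g_metric :: "real \<Rightarrow> (real \<Rightarrow> real) \<Rightarrow> metric" where
  "g_metric lam q p = (let t = p $ 3; h = h_metric lam t in
     vector [vector [h $ 1 $ 1, h $ 1 $ 2, 0],
             vector [h $ 2 $ 1, h $ 2 $ 2, 0],
             vector [0, 0, (q t)^2]])"

end

theory Submission
  imports Defs
begin

text \<open>
  The stable norm is computed by a calibration. On a three-manifold a 2-covector is the same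
  thing as a tangent vector: \<open>flux_form W\<close> evaluates \<open>(u, v)\<close> as \<open>W \<bullet> (u \<times> v)\<close>. For a metric
  \<open>g = B\<^sup>T B\<close> with \<open>det B > 0\<close> the comass of this covector is \<open>|B W| / det B\<close>
  (\<open>comass_le_one_iff\<close>). Suppose that \<open>\<alpha>\<close> is a closed 1-form in the given de Rham class, that
  \<open>W\<close> has comass 1 everywhere and defines a closed 2-form, and that \<open>\<alpha>\<close> is a non-negative
  multiple of the \<open>g\<close>-dual of \<open>W\<close>. Every current in the class has the same value on the closed
  form given by \<open>W\<close>, and this bounds its mass from below. By the Cauchy-Schwarz inequality the
  current \<open>\<beta> \<mapsto> \<integral> \<beta> \<and> \<alpha>\<close> attains the bound (\<open>stable_norm_calibration\<close>).

  For \<open>g = q\<^sup>2 dt\<^sup>2 + h(t)\<close> all data may be chosen to depend on \<open>t\<close> only. Let \<open>n(t)\<close> be the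
  length of \<open>a dx + b dy\<close> in the metric dual to \<open>h(t)\<close>, let \<open>r = sqrt (a\<^sup>2 + b\<^sup>2)\<close> and
  \<open>R = sqrt (a\<^sup>2 + b\<^sup>2 + c\<^sup>2)\<close>, and suppose \<open>r > 0\<close>. The right representative is
  \<open>\<alpha> = a dx + b dy + (c / r) q n dt\<close>: both parts of it then have lengths proportional to
  \<open>n\<close>, so the third component of the dual unit vector field \<open>W\<close>, normalised by the volume
  density, is the constant \<open>c / R\<close>, which makes the 2-form closed. That \<open>\<alpha>\<close> lies in the class
  of \<open>a dx + b dy + c dt\<close> means \<open>\<integral> q n = r\<close>. This is where the hypothesis on \<open>q\<close> enters:
  a rotation by \<open>\<pi>\<close> leaves \<open>h\<close> unchanged, so \<open>n\<close> has period \<open>1/2\<close>, and \<open>q\<close> may be replaced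
  by its average \<open>1 / \<kappa>\<close> over half a period; moreover \<open>\<integral> n = r \<kappa>\<close> because rotating \<open>(a, b)\<close>
  only shifts \<open>t\<close>. The value of the calibration on the class is then \<open>r\<^sup>2 / R + c\<^sup>2 / R = R\<close>.
  The same averaging gives the volume \<open>\<integral> q = 1 / \<kappa>\<close>, since \<open>det h = 1\<close>.

  The metric is not flat for any \<open>q\<close>: by the Gauss equation the curvature of the planes spanned
  by \<open>x\<close> and \<open>y\<close> is minus the determinant of the second fundamental form of the torus
  \<open>t = const\<close>, hence proportional to \<open>- det h'\<close>. At \<open>t = 0\<close> the matrix \<open>h'\<close> is off-diagonal
  and non-zero.
\<close>

section \<open>Closure properties of smooth functions\<close>

lemma smooth_differentiable: "smooth f \<Longrightarrow> f differentiable at x"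
  unfolding smooth_def by (metis fold_simps(1))

lemma smooth_dirderiv: "smooth f \<Longrightarrow> smooth (dirderiv v f)"
  unfolding smooth_def by (metis fold_simps(2))

text \<open>
  Smoothness is a coinductive notion: a class of differentiable functions that is stable under
  directional derivatives consists of smooth functions.
\<close>

lemma smooth_coinduct:
  assumes "P f"
    and "\<And>f. P f \<Longrightarrow> (\<forall>x. f differentiable at x) \<and> (\<forall>v. P (dirderiv v f))"
  shows "smooth f"
proof -
  have "dirderivs vs f differentiable at x" for vs x
    using assms(1) by (induction vs arbitrary: f) (auto dest: assms(2))
  then show ?thesis by (simp add: smooth_def)
qed

lemma smoothI:
  assumes "\<And>x. f differentiable at x" and "\<And>v. smooth (dirderiv v f)"
  shows "smooth f"
  by (rule smooth_coinduct[where P = "\<lambda>h. h = f \<or> smooth h"])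
    (use assms in \<open>auto intro: smooth_differentiable smooth_dirderiv\<close>)

lemma dirderiv_eqI: "(f has_derivative f') (at x) \<Longrightarrow> dirderiv v f x = f' v"
  unfolding dirderiv_def using frechet_derivative_at by metis

lemma has_derivative_dirderiv:
  "f differentiable at x \<Longrightarrow> (f has_derivative (\<lambda>v. dirderiv v f x)) (at x)"
  unfolding dirderiv_def using frechet_derivative_works by (metis (no_types, lifting) eta_contract_eq)

lemma smooth_continuous_on: "smooth f \<Longrightarrow> continuous_on S f"
  by (meson continuous_at_imp_continuous_on differentiable_imp_continuous_within smooth_differentiable)

lemma has_derivative_smooth_compose:
  fixes \<phi> :: "real \<Rightarrow> real" and L :: "'a::real_normed_vector \<Rightarrow> real"
  assumes "smooth \<phi>" and "bounded_linear L"
  shows "((\<lambda>x. \<phi> (L x)) has_derivative (\<lambda>v. L v * dirderiv 1 \<phi> (L x))) (at x)"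
proof -
  have d: "(\<phi> has_derivative (\<lambda>v. dirderiv v \<phi> (L x))) (at (L x))"
    by (simp add: assms(1) has_derivative_dirderiv smooth_differentiable)
  have "dirderiv v \<phi> (L x) = v * dirderiv 1 \<phi> (L x)" for v
    using linear_cmul[OF has_derivative_linear[OF d], of v 1] by simp
  then have "(\<phi> has_derivative (\<lambda>v. v * dirderiv 1 \<phi> (L x))) (at (L x))"
    by (intro has_derivative_eq_rhs[OF d] ext)
  then show ?thesis
    using has_derivative_compose[OF bounded_linear_imp_has_derivative[OF assms(2)]] by blast
qed

text \<open>
  The derivatives of a product or of a composition are again sums of products of functions of the
  same kind, but not of the same shape. Closing the smooth functions under all operations at once
  yields a class that is stable under derivatives, so that one coinduction serves for all of them.
\<close>

inductive smooth_expr :: "('a::real_normed_vector \<Rightarrow> real) \<Rightarrow> bool" where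
  base: "smooth f \<Longrightarrow> smooth_expr f"
| const: "smooth_expr (\<lambda>x. c)"
| linear: "bounded_linear f \<Longrightarrow> smooth_expr f"
| compose: "smooth \<phi> \<Longrightarrow> bounded_linear L \<Longrightarrow> smooth_expr (\<lambda>x. \<phi> (L x :: real))"
| add: "smooth_expr f \<Longrightarrow> smooth_expr g \<Longrightarrow> smooth_expr (\<lambda>x. f x + g x)"
| mult: "smooth_expr f \<Longrightarrow> smooth_expr g \<Longrightarrow> smooth_expr (\<lambda>x. f x * g x)"
| inverse: "smooth_expr f \<Longrightarrow> (\<And>x. f x \<noteq> 0) \<Longrightarrow> smooth_expr (\<lambda>x. inverse (f x))"
| sqrt: "smooth_expr f \<Longrightarrow> (\<And>x. f x > 0) \<Longrightarrow> smooth_expr (\<lambda>x. sqrt (f x))"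
| sin: "smooth_expr f \<Longrightarrow> smooth_expr (\<lambda>x. sin (f x))"
| cos: "smooth_expr f \<Longrightarrow> smooth_expr (\<lambda>x. cos (f x))"

lemma smooth_expr_derivative:
  "smooth_expr f \<Longrightarrow> \<exists>D. (\<forall>x. (f has_derivative (\<lambda>v. D v x)) (at x)) \<and> (\<forall>v. smooth_expr (D v))"
proof (induction rule: smooth_expr.induct)
  case (base f)
  then show ?case
    by (intro exI[where x = "\<lambda>v. dirderiv v f"])
      (auto intro!: has_derivative_dirderiv smooth_differentiable smooth_expr.base smooth_dirderiv)
next
  case (const c)
  show ?case by (rule exI[where x = "\<lambda>v x. 0"]) (auto intro: smooth_expr.const)
next
  case (linear f)
  then show ?case
    by (intro exI[where x = "\<lambda>v x. f v"])
      (auto intro: smooth_expr.const bounded_linear_imp_has_derivative)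
next
  case (compose \<phi> L)
  then show ?case
    by (intro exI[where x = "\<lambda>v x. L v * dirderiv 1 \<phi> (L x)"] conjI allI
        has_derivative_smooth_compose smooth_expr.mult[OF smooth_expr.const] smooth_expr.compose
        smooth_dirderiv)
next
  case (add f g)
  then obtain D E where "\<forall>x. (f has_derivative (\<lambda>v. D v x)) (at x)" "\<forall>v. smooth_expr (D v)"
    "\<forall>x. (g has_derivative (\<lambda>v. E v x)) (at x)" "\<forall>v. smooth_expr (E v)" by blast
  then show ?case
    by (intro exI[where x = "\<lambda>v x. D v x + E v x"])
      (auto intro!: smooth_expr.add has_derivative_add)
next
  case (mult f g)
  then obtain D E where "\<forall>x. (f has_derivative (\<lambda>v. D v x)) (at x)" "\<forall>v. smooth_expr (D v)"
    "\<forall>x. (g has_derivative (\<lambda>v. E v x)) (at x)" "\<forall>v. smooth_expr (E v)" by blast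
  with mult.hyps show ?case
    by (intro exI[where x = "\<lambda>v x. f x * E v x + D v x * g x"])
      (auto intro!: smooth_expr.add smooth_expr.mult has_derivative_mult)
next
  case (inverse f)
  then obtain D where D: "\<forall>x. (f has_derivative (\<lambda>v. D v x)) (at x)" "\<forall>v. smooth_expr (D v)"
    by blast
  have d: "((\<lambda>x. inverse (f x)) has_derivative
      (\<lambda>v. (-1) * (inverse (f x) * D v x * inverse (f x)))) (at x)" for x
    using Deriv.has_derivative_inverse[OF inverse.hyps(2) D(1)[rule_format], of x] by simp
  show ?case
    by (intro exI[where x = "\<lambda>v x. (-1) * (inverse (f x) * D v x * inverse (f x))"] conjI allI d
        smooth_expr.mult smooth_expr.const smooth_expr.inverse)
      (use D inverse.hyps in auto)
next
  case (sqrt f)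
  then obtain D where D: "\<forall>x. (f has_derivative (\<lambda>v. D v x)) (at x)" "\<forall>v. smooth_expr (D v)"
    by blast
  have d: "((\<lambda>x. sqrt (f x)) has_derivative (\<lambda>v. D v x * ((1/2) * inverse (sqrt (f x))))) (at x)" for x
    by (rule has_derivative_eq_rhs[OF DERIV_compose_FDERIV[OF DERIV_real_sqrt[OF sqrt.hyps(2)]
            D(1)[rule_format]]]) (simp add: fun_eq_iff)
  have nz: "sqrt (f x) \<noteq> 0" for x using sqrt.hyps(2)[of x] by simp
  show ?case
    by (intro exI[where x = "\<lambda>v x. D v x * ((1/2) * inverse (sqrt (f x)))"] conjI allI d
        smooth_expr.mult smooth_expr.const smooth_expr.inverse smooth_expr.sqrt)
      (use D sqrt.hyps nz in auto)
next
  case (sin f)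
  then obtain D where D: "\<forall>x. (f has_derivative (\<lambda>v. D v x)) (at x)" "\<forall>v. smooth_expr (D v)"
    by blast
  then show ?case
    using sin.hyps
    by (intro exI[where x = "\<lambda>v x. D v x * cos (f x)"] conjI allI smooth_expr.mult smooth_expr.cos
        has_derivative_sin) auto
next
  case (cos f)
  then obtain D where D: "\<forall>x. (f has_derivative (\<lambda>v. D v x)) (at x)" "\<forall>v. smooth_expr (D v)"
    by blast
  have d: "((\<lambda>x. cos (f x)) has_derivative (\<lambda>v. D v x * ((-1) * sin (f x)))) (at x)" for x
    using has_derivative_cos[OF D(1)[rule_format], of x] by simp
  show ?case
    by (intro exI[where x = "\<lambda>v x. D v x * ((-1) * sin (f x))"] conjI allI d
        smooth_expr.mult smooth_expr.const smooth_expr.sin)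
      (use D cos.hyps in auto)
qed

lemma smooth_expr_smooth: "smooth_expr f \<Longrightarrow> smooth f"
proof (erule smooth_coinduct)
  fix f :: "'a \<Rightarrow> real"
  assume "smooth_expr f"
  then obtain D where D: "\<forall>x. (f has_derivative (\<lambda>v. D v x)) (at x)" "\<forall>v. smooth_expr (D v)"
    using smooth_expr_derivative by blast
  have "dirderiv v f = D v" for v using D(1) dirderiv_eqI by blast
  with D show "(\<forall>x. f differentiable at x) \<and> (\<forall>v. smooth_expr (dirderiv v f))"
    by (auto intro: differentiableI)
qed

lemma smooth_const: "smooth (\<lambda>x. c :: real)"
  by (rule smooth_expr_smooth) (rule smooth_expr.const)

lemma smooth_linear: "bounded_linear f \<Longrightarrow> smooth (f :: 'a::real_normed_vector \<Rightarrow> real)"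
  by (rule smooth_expr_smooth) (rule smooth_expr.linear)

lemma smooth_compose_linear:
  "smooth \<phi> \<Longrightarrow> bounded_linear L \<Longrightarrow> smooth (\<lambda>x. \<phi> (L x :: real) :: real)"
  by (rule smooth_expr_smooth) (rule smooth_expr.compose)

lemma smooth_add: "smooth f \<Longrightarrow> smooth g \<Longrightarrow> smooth (\<lambda>x. f x + g x :: real)"
  by (rule smooth_expr_smooth, rule smooth_expr.add; (rule smooth_expr.base)?)

lemma smooth_mult: "smooth f \<Longrightarrow> smooth g \<Longrightarrow> smooth (\<lambda>x. f x * g x :: real)"
  by (rule smooth_expr_smooth, rule smooth_expr.mult; (rule smooth_expr.base)?)

lemma smooth_sin: "smooth f \<Longrightarrow> smooth (\<lambda>x. sin (f x) :: real)"
  by (rule smooth_expr_smooth, rule smooth_expr.sin; (rule smooth_expr.base)?)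

lemma smooth_cos: "smooth f \<Longrightarrow> smooth (\<lambda>x. cos (f x) :: real)"
  by (rule smooth_expr_smooth, rule smooth_expr.cos; (rule smooth_expr.base)?)

lemma smooth_sqrt: "smooth f \<Longrightarrow> (\<And>x. f x > 0) \<Longrightarrow> smooth (\<lambda>x. sqrt (f x))"
  by (rule smooth_expr_smooth, rule smooth_expr.sqrt; (rule smooth_expr.base)?)

lemma smooth_divide:
  "smooth f \<Longrightarrow> smooth g \<Longrightarrow> (\<And>x. g x \<noteq> 0) \<Longrightarrow> smooth (\<lambda>x. f x / g x :: real)"
  unfolding divide_inverse
  by (rule smooth_mult, assumption, rule smooth_expr_smooth, rule smooth_expr.inverse,
      rule smooth_expr.base)

lemma smooth_minus: "smooth f \<Longrightarrow> smooth (\<lambda>x. - f x :: real)"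
  using smooth_mult[OF smooth_const[of "-1"]] by simp

lemma smooth_diff: "smooth f \<Longrightarrow> smooth g \<Longrightarrow> smooth (\<lambda>x. f x - g x :: real)"
  using smooth_add[OF _ smooth_minus, of f g] by simp

lemma smooth_power: "smooth f \<Longrightarrow> smooth (\<lambda>x. (f x :: real) ^ n)"
  by (induction n) (auto intro: smooth_const smooth_mult)

lemma smooth_sum: "(\<And>i. i \<in> I \<Longrightarrow> smooth (f i)) \<Longrightarrow> smooth (\<lambda>x. \<Sum>i\<in>I. f i x :: real)"
  by (induction I rule: infinite_finite_induct) (auto intro: smooth_const smooth_add)

lemmas smooth_intros = smooth_const smooth_add smooth_mult smooth_minus smooth_diff smooth_sin
  smooth_cos smooth_power smooth_sqrt smooth_divide smooth_sum

lemma smooth_lift: "smooth \<phi> \<Longrightarrow> smooth (\<lambda>p :: real^'n. \<phi> (p $ i) :: real)"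
  by (rule smooth_compose_linear[OF _ bounded_linear_vec_nth])

lemma dirderiv_lift:
  fixes \<phi> :: "real \<Rightarrow> real"
  shows "smooth \<phi> \<Longrightarrow> dirderiv v (\<lambda>p :: real^'n. \<phi> (p $ i)) p = v $ i * dirderiv 1 \<phi> (p $ i)"
  by (intro dirderiv_eqI has_derivative_smooth_compose bounded_linear_vec_nth)

lemma smooth_antiderivative:
  fixes F f :: "real \<Rightarrow> real"
  assumes "smooth f" and "\<And>t. (F has_real_derivative f t) (at t)"
  shows "smooth F"
proof (rule smoothI)
  show "F differentiable at t" for t
    using assms(2) has_field_derivative_imp_has_derivative differentiableI by blast
  have "dirderiv v F = (\<lambda>t. v * f t)" for v
    using dirderiv_eqI[OF assms(2)[unfolded has_field_derivative_def]] by (simp add: fun_eq_iff)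
  then show "smooth (dirderiv v F)" for v
    by (simp add: assms(1) smooth_const smooth_mult)
qed

section \<open>Integration over the torus\<close>

lemma integral_split_at:
  fixes f :: "'a::euclidean_space \<Rightarrow> real"
  assumes "continuous_on UNIV f" and "k \<in> Basis"
    and "\<And>x. x \<in> cbox a b \<and> x \<bullet> k \<le> c \<longleftrightarrow> x \<in> cbox a b'"
    and "\<And>x. x \<in> cbox a b \<and> x \<bullet> k \<ge> c \<longleftrightarrow> x \<in> cbox a' b"
  shows "integral (cbox a b) f = integral (cbox a b') f + integral (cbox a' b) f"
proof (rule integral_unique, rule has_integral_split[OF _ _ assms(2)])
  have e: "cbox a b \<inter> {x. x \<bullet> k \<le> c} = cbox a b'" "cbox a b \<inter> {x. c \<le> x \<bullet> k} = cbox a' b"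
    using assms(3,4) by blast+
  have i: "f integrable_on cbox u v" for u v
    by (rule integrable_continuous) (use assms(1) continuous_on_subset in blast)
  show "(f has_integral integral (cbox a b') f) (cbox a b \<inter> {x. x \<bullet> k \<le> c})"
    "(f has_integral integral (cbox a' b) f) (cbox a b \<inter> {x. x \<bullet> k \<ge> c})"
    unfolding e by (rule integrable_integral[OF i])+
qed

text \<open>
  The translated box and the original one share a middle part; the two remaining end pieces differ
  by the translation \<open>k\<close> itself.
\<close>

lemma integral_translate_periodic:
  fixes f :: "'a::euclidean_space \<Rightarrow> real"
  assumes f: "continuous_on UNIV f" and k: "k \<in> Basis" and per: "\<And>x. f (x + k) = f x"
    and ab: "b \<bullet> k = a \<bullet> k + 1" and s: "0 \<le> s" "s \<le> 1"
  shows "integral (cbox a b) (\<lambda>x. f (x + s *\<^sub>R k)) = integral (cbox a b) f"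
proof -
  have dot: "(x + c *\<^sub>R k) \<bullet> j = x \<bullet> j + (if j = k then c else 0)" if "j \<in> Basis" for x j c
    using that k by (auto simp: inner_add_left inner_Basis)
  have box: "x \<in> cbox (a + c *\<^sub>R k) (b + d *\<^sub>R k) \<longleftrightarrow>
      (\<forall>j\<in>Basis - {k}. a \<bullet> j \<le> x \<bullet> j \<and> x \<bullet> j \<le> b \<bullet> j) \<and> a \<bullet> k + c \<le> x \<bullet> k \<and> x \<bullet> k \<le> b \<bullet> k + d"
    for x c d
    using k by (auto simp: mem_box dot split: if_splits)
  note box' = box box[of _ 0, simplified] box[of _ 1, simplified] box[of _ _ 0, simplified] box[of _ 0 0, simplified]
  have "integral (cbox a b) (\<lambda>x. f (x + s *\<^sub>R k)) = integral (cbox (a + s *\<^sub>R k) (b + s *\<^sub>R k)) f"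
    using integral_shift_cbox_plus[of a b f "s *\<^sub>R k"] by (simp add: o_def add.commute)
  also have "\<dots> = integral (cbox (a + s *\<^sub>R k) b) f + integral (cbox (a + 1 *\<^sub>R k) (b + s *\<^sub>R k)) f"
    by (rule integral_split_at[OF f k, where c = "b \<bullet> k"])
      (use s ab in \<open>auto simp: box'\<close>)
  also have "integral (cbox (a + 1 *\<^sub>R k) (b + s *\<^sub>R k)) f = integral (cbox a (b + (s - 1) *\<^sub>R k)) f"
    using integral_shift_cbox_plus[of a "b + (s - 1) *\<^sub>R k" f k]
    by (simp add: o_def add.commute[of k] per scaleR_left_diff_distrib)
  also have "integral (cbox (a + s *\<^sub>R k) b) f + integral (cbox a (b + (s - 1) *\<^sub>R k)) f
      = integral (cbox a b) f"
    unfolding add.commute[of "integral (cbox (a + s *\<^sub>R k) b) f"]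
    by (rule integral_split_at[symmetric, OF f k, where c = "a \<bullet> k + s"])
      (use s ab in \<open>auto simp: box'\<close>)
  finally show ?thesis .
qed

text \<open>
  Stokes' theorem on the torus, without Fubini: translating a periodic function does not change its
  integral, so the derivative of the integral with respect to the translation parameter vanishes,
  and it may be computed under the integral sign.
\<close>

lemma integral_derivative_periodic:
  fixes f f' :: "'a::euclidean_space \<Rightarrow> real"
  assumes der: "\<And>x. ((\<lambda>s. f (x + s *\<^sub>R k)) has_real_derivative f' x) (at 0)"
    and f: "continuous_on UNIV f" and f': "continuous_on UNIV f'"
    and k: "k \<in> Basis" and per: "\<And>x. f (x + k) = f x" and ab: "b \<bullet> k = a \<bullet> k + 1"
  shows "integral (cbox a b) f' = 0"
proof -
  have der_s: "((\<lambda>s. f (x + s *\<^sub>R k)) has_real_derivative f' (x + s *\<^sub>R k)) (at s within {0..1})" for x s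
  proof -
    have "((\<lambda>u. f (x + s *\<^sub>R k + u *\<^sub>R k)) has_real_derivative f' (x + s *\<^sub>R k)) (at (- s + s))"
      using der[of "x + s *\<^sub>R k"] by simp
    from DERIV_at_within_shift[of "\<lambda>u. f (x + s *\<^sub>R k + u *\<^sub>R k)" "f' (x + s *\<^sub>R k)" "-s" s UNIV]
      this
    have "((\<lambda>v. f (x + v *\<^sub>R k)) has_real_derivative f' (x + s *\<^sub>R k)) (at s)"
      by (simp add: algebra_simps)
    then show ?thesis by (rule has_field_derivative_at_within)
  qed
  have cont: "continuous_on S (\<lambda>x. h (x + s *\<^sub>R k))"
    if "continuous_on UNIV h" for h :: "'a \<Rightarrow> real" and s S
    by (rule continuous_on_compose2[OF that]) (auto intro!: continuous_intros)
  have "((\<lambda>s. integral (cbox a b) (\<lambda>x. f (x + s *\<^sub>R k))) has_real_derivative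
      integral (cbox a b) (\<lambda>x. f' (x + 0 *\<^sub>R k))) (at 0 within {0..1})"
  proof (rule leibniz_rule_field_derivative[where f = "\<lambda>s x. f (x + s *\<^sub>R k)"
        and fx = "\<lambda>s x. f' (x + s *\<^sub>R k)"])
    show "continuous_on ({0..1} \<times> cbox a b) (\<lambda>(s, x). f' (x + s *\<^sub>R k))"
      unfolding case_prod_unfold
      by (rule continuous_on_compose2[OF f']) (auto intro!: continuous_intros)
  qed (auto intro!: der_s integrable_continuous cont f)
  from has_field_derivative_transform_within[OF this zero_less_one]
  have "((\<lambda>s. integral (cbox a b) f) has_real_derivative integral (cbox a b) f')
      (at (0::real) within {0..1})"
    by (simp add: integral_translate_periodic[OF f k per ab])
  then show ?thesis
    using has_real_derivative_iff_has_vector_derivative vector_derivative_unique_within_closed_interval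
      [of 0 1 0 "\<lambda>s. integral (cbox a b) f" "integral (cbox a b) f'" 0] by auto
qed

lemma torus_integral_dirderiv:
  assumes f: "smooth f" and "periodic3 f"
  shows "torus_integral (dirderiv (ax i) f) = 0"
  unfolding torus_integral_def
proof (rule integral_derivative_periodic)
  show "((\<lambda>s. f (x + s *\<^sub>R ax i)) has_real_derivative dirderiv (ax i) f x) (at 0)" for x
  proof -
    have d: "(f has_derivative (\<lambda>v. dirderiv v f x)) (at (x + 0 *\<^sub>R ax i))"
      using f by (simp add: has_derivative_dirderiv smooth_differentiable)
    have "((\<lambda>s. x + s *\<^sub>R ax i) has_derivative (\<lambda>s. s *\<^sub>R ax i)) (at 0)"
      by (auto intro!: derivative_eq_intros)
    from has_derivative_compose[OF this d]
    have "((\<lambda>s. f (x + s *\<^sub>R ax i)) has_derivative (\<lambda>s. dirderiv (s *\<^sub>R ax i) f x)) (at 0)" by simp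
    moreover have "dirderiv (s *\<^sub>R ax i) f x = dirderiv (ax i) f x * s" for s
      using linear_cmul[OF has_derivative_linear[OF d], of s "ax i"] by (simp add: mult.commute)
    ultimately show ?thesis by (simp add: has_field_derivative_def)
  qed
qed (use assms in \<open>auto simp: periodic3_def inner_axis axis_in_Basis_iff
    intro!: smooth_continuous_on smooth_dirderiv\<close>)

lemma periodic_antiderivative:
  fixes f :: "real \<Rightarrow> real"
  assumes f: "continuous_on UNIV f" and per: "\<And>t. f (t + 1) = f t"
  obtains F where "\<And>t. (F has_real_derivative f t - integral {0..1} f) (at t)"
    and "\<And>t. F (t + 1) = F t"
proof -
  define m where "m = integral {0..1} f"
  have "\<exists>F. \<forall>t. (-\<infinity>::ereal) < t \<longrightarrow> t < (\<infinity>::ereal) \<longrightarrow> (F has_vector_derivative f t) (at t)"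
    by (rule einterval_antiderivative) (use f in \<open>auto simp: continuous_on_eq_continuous_at\<close>)
  then obtain G where G: "\<And>t. (G has_real_derivative f t) (at t)"
    by (auto simp: has_real_derivative_iff_has_vector_derivative)
  define F where "F t = G t - m * t" for t
  have F: "(F has_real_derivative f t - m) (at t)" for t
    unfolding F_def by (auto intro!: derivative_eq_intros G)
  have "((\<lambda>t. F (t + 1) - F t) has_real_derivative 0) (at t)" for t
    using DERIV_diff[OF DERIV_shift[THEN iffD1, OF F[of "t + 1"]] F[of t]] by (simp add: per)
  then have "F (t + 1) - F t = F (0 + 1) - F 0" for t
    using DERIV_isconst_all by blast
  moreover have "(f has_integral G 1 - G 0) {0..1}"
    using G by (intro fundamental_theorem_of_calculus)
      (auto simp: has_real_derivative_iff_has_vector_derivative[symmetric]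
        intro: has_field_derivative_at_within)
  then have "F (0 + 1) - F 0 = 0" by (simp add: F_def m_def integral_unique)
  ultimately have "F (t + 1) = F t" for t by simp
  with that F show thesis unfolding m_def by blast
qed

lemma smooth_periodic_antiderivative:
  fixes f :: "real \<Rightarrow> real"
  assumes f: "smooth f" and per: "\<And>t. f (t + 1) = f t"
  obtains F where "smooth F" "\<And>t. dirderiv 1 F t = f t - integral {0..1} f" "\<And>t. F (t + 1) = F t"
proof -
  obtain F where F: "\<And>t. (F has_real_derivative f t - integral {0..1} f) (at t)"
    "\<And>t. F (t + 1) = F t"
    using periodic_antiderivative[OF smooth_continuous_on[OF f] per] by blast
  have "smooth F" by (rule smooth_antiderivative[OF _ F(1)]) (intro smooth_intros f)
  moreover have "dirderiv 1 F t = f t - integral {0..1} f" for t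
    using dirderiv_eqI[OF F(1)[unfolded has_field_derivative_def]] by simp
  ultimately show thesis using that F(2) by blast
qed

lemma integral_translate_periodic_real:
  fixes f :: "real \<Rightarrow> real"
  assumes "continuous_on UNIV f" and "\<And>t. f (t + 1) = f t" and "0 \<le> s" "s \<le> 1"
  shows "integral {0..1} (\<lambda>t. f (t + s)) = integral {0..1} f"
  using integral_translate_periodic[of f 1 1 0 s] assms by simp

lemma periodic3_lift:
  assumes "\<And>t :: real. \<phi> (t + 1) = \<phi> t"
  shows "periodic3 (\<lambda>p. \<phi> (p $ 3))"
  using assms by (auto simp: periodic3_def axis_def)

text \<open>
  A function of \<open>t\<close> minus its mean is the \<open>t\<close>-derivative of a periodic function, so this reduction
  to a one-dimensional integral is another instance of Stokes' theorem.
\<close>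

lemma torus_integral_lift:
  assumes f: "smooth f" and per: "\<And>t. f (t + 1) = f t"
  shows "torus_integral (\<lambda>p. f (p $ 3)) = integral {0..1} f"
proof -
  obtain F where F: "smooth F" "\<And>t. dirderiv 1 F t = f t - integral {0..1} f" "\<And>t. F (t + 1) = F t"
    using smooth_periodic_antiderivative[OF assms] by blast
  have "torus_integral (dirderiv (ax 3) (\<lambda>p. F (p $ 3))) = 0"
    by (intro torus_integral_dirderiv smooth_lift periodic3_lift F)
  then have "torus_integral (\<lambda>p. f (p $ 3) - integral {0..1} f) = 0"
    by (simp add: dirderiv_lift[OF F(1), abs_def] F(2))
  moreover have "torus_integral (\<lambda>p. f (p $ 3) - integral {0..1} f)
      = torus_integral (\<lambda>p. f (p $ 3)) - integral (cbox (0::real^3) 1) (\<lambda>p. integral {0..1} f)"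
    unfolding torus_integral_def
    by (rule Henstock_Kurzweil_Integration.integral_diff)
      (auto intro!: integrable_continuous smooth_continuous_on[OF smooth_lift] smooth_continuous_on[OF smooth_const] f)
  moreover have "Henstock_Kurzweil_Integration.content (cbox (0::real^3) 1) = 1"
  proof -
    have "(0::real^3) \<in> cbox 0 1" by (simp add: mem_box_cart)
    then show ?thesis by (subst content_cbox_cart) auto
  qed
  ultimately show ?thesis by simp
qed

lemma
  assumes "continuous_on UNIV f" and "continuous_on UNIV g"
  shows torus_integral_add: "torus_integral (\<lambda>p. f p + g p) = torus_integral f + torus_integral g"
    and torus_integral_diff: "torus_integral (\<lambda>p. f p - g p) = torus_integral f - torus_integral g"
  using assms unfolding torus_integral_def
  by (auto intro!: Henstock_Kurzweil_Integration.integral_add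
      Henstock_Kurzweil_Integration.integral_diff integrable_continuous
      intro: continuous_on_subset)

lemma torus_integral_sum:
  assumes "finite J" and "\<And>j. j \<in> J \<Longrightarrow> continuous_on UNIV (f j)"
  shows "torus_integral (\<lambda>p. \<Sum>j\<in>J. f j p) = (\<Sum>j\<in>J. torus_integral (f j))"
  using assms unfolding torus_integral_def
  by (auto intro!: Henstock_Kurzweil_Integration.integral_sum integrable_continuous
      intro: continuous_on_subset)

lemma torus_integral_cmult: "torus_integral (\<lambda>p. c * f p) = c * torus_integral f"
  unfolding torus_integral_def by simp

lemma torus_integral_mono:
  assumes "continuous_on UNIV f" and "continuous_on UNIV g" and "\<And>p. f p \<le> g p"
  shows "torus_integral f \<le> torus_integral g"
  using assms unfolding torus_integral_def
  by (auto intro!: Henstock_Kurzweil_Integration.integral_le integrable_continuous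
      intro: continuous_on_subset)

lemma dirderiv_mult:
  fixes f g :: "'a::real_normed_vector \<Rightarrow> real"
  assumes "smooth f" and "smooth g"
  shows "dirderiv v (\<lambda>x. f x * g x) x = f x * dirderiv v g x + dirderiv v f x * g x"
  by (rule dirderiv_eqI, rule has_derivative_mult)
    (use assms in \<open>auto intro!: has_derivative_dirderiv smooth_differentiable\<close>)

lemma torus_integral_by_parts:
  assumes \<phi>: "smooth \<phi>" "\<And>t. \<phi> (t + 1) = \<phi> t" and f: "smooth f" "periodic3 f"
  shows "torus_integral (\<lambda>p. \<phi> (p $ 3) * dirderiv (ax i) f p)
    = - torus_integral (\<lambda>p. (ax i) $ 3 * dirderiv 1 \<phi> (p $ 3) * f p)"
proof -
  note s = smooth_lift[OF \<phi>(1), of 3] smooth_lift[OF smooth_dirderiv[OF \<phi>(1)], where i = 3] f(1)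
    smooth_dirderiv[OF f(1)] smooth_const
  have "0 = torus_integral (dirderiv (ax i) (\<lambda>p. \<phi> (p $ 3) * f p))"
    using periodic3_lift[of \<phi>, OF \<phi>(2)] f(2)
    by (intro torus_integral_dirderiv[symmetric] smooth_mult s) (simp add: periodic3_def)
  also have "\<dots> = torus_integral
      (\<lambda>p. \<phi> (p $ 3) * dirderiv (ax i) f p + (ax i) $ 3 * dirderiv 1 \<phi> (p $ 3) * f p)"
    by (simp add: dirderiv_mult[OF s(1,3), abs_def] dirderiv_lift[OF \<phi>(1)])
  also have "\<dots> = torus_integral (\<lambda>p. \<phi> (p $ 3) * dirderiv (ax i) f p)
      + torus_integral (\<lambda>p. (ax i) $ 3 * dirderiv 1 \<phi> (p $ 3) * f p)"
    by (intro torus_integral_add smooth_continuous_on smooth_mult s)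
  finally show ?thesis by simp
qed

section \<open>Forms and currents depending on the third coordinate\<close>

definition covector_form :: "(real \<Rightarrow> real^3) \<Rightarrow> form" where
  "covector_form \<alpha> = (\<lambda>p vs. case vs of [v] \<Rightarrow> \<alpha> (p $ 3) \<bullet> v | _ \<Rightarrow> 0)"

definition flux_form :: "(real \<Rightarrow> real^3) \<Rightarrow> form" where
  "flux_form W = (\<lambda>p vs. case vs of [u, v] \<Rightarrow> W (p $ 3) \<bullet> cross3 u v | _ \<Rightarrow> 0)"

text \<open>
  The vector that represents a 2-form at a point through the cross product: the components are
  those of the form on the coordinate planes, the middle one with the opposite orientation.
\<close>

definition flux :: "form \<Rightarrow> real^3 \<Rightarrow> real^3" where
  "flux \<beta> p = vector [\<beta> p [ax 2, ax 3], - \<beta> p [ax 1, ax 3], \<beta> p [ax 1, ax 2]]"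

definition pd_current :: "(real \<Rightarrow> real^3) \<Rightarrow> current" where
  "pd_current \<alpha> = (\<lambda>\<beta>. form_integral (wedge1 \<beta> (covector_form \<alpha>)))"

definition smooth_loop :: "(real \<Rightarrow> real^3) \<Rightarrow> bool" where
  "smooth_loop \<alpha> \<longleftrightarrow> (\<forall>i. smooth (\<lambda>t. \<alpha> t $ i)) \<and> (\<forall>t. \<alpha> (t + 1) = \<alpha> t)"

lemma const_form1_eq: "const_form1 a b c = covector_form (\<lambda>t. vector [a, b, c])"
  by (auto simp: const_form1_def covector_form_def inner_vec_def sum_3 fun_eq_iff split: list.split)

lemma axis3_expansion: "u = u $ 1 *\<^sub>R ax 1 + u $ 2 *\<^sub>R ax 2 + u $ 3 *\<^sub>R ax 3"
  using basis_expansion[of u] by (simp add: sum_3 scalar_mult_eq_scaleR)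

lemma dirderiv_constant:
  assumes "\<And>x. f x = c"
  shows "dirderiv v f x = 0"
proof -
  have "f = (\<lambda>x. c)" using assms by auto
  then show ?thesis by (simp add: dirderiv_eqI[OF has_derivative_const])
qed

lemma ax_nth: "ax i $ j = (if j = i then 1 else 0)"
  by (simp add: axis_def)

lemma forms_2_eq_flux:
  assumes "\<beta> \<in> forms 2"
  shows "\<beta> p [u, v] = flux \<beta> p \<bullet> cross3 u v"
proof -
  have "\<And>vs i. length vs = 2 \<and> i < 2 \<Longrightarrow> linear (\<lambda>w. \<beta> p (vs[i := w]))"
    using assms unfolding forms_def by blast
  from this[of "[u, v]" for u v] have l: "linear (\<lambda>w. \<beta> p ([u, v][i := w]))" if "i < 2" for i u v
    using that by simp
  have l1: "linear (\<lambda>u. \<beta> p [u, v])" and l2: "linear (\<lambda>v. \<beta> p [u, v])" for u v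
    using l[of 0] l[of 1] by simp_all
  note lin = linear_add[OF l1] linear_add[OF l2] linear_cmul[OF l1] linear_cmul[OF l2]
  have "\<And>vs i j. length vs = 2 \<and> i < j \<and> j < 2 \<and> vs ! i = vs ! j \<Longrightarrow> \<beta> p vs = 0"
    using assms unfolding forms_def by blast
  from this[of "[u, u]" 0 1 for u] have alt: "\<beta> p [u, u] = 0" for u by simp
  have anti: "\<beta> p [v, u] = - \<beta> p [u, v]" for u v
    using alt[of "u + v"] unfolding lin by (simp add: alt)
  note a = anti[of "ax 2" "ax 1"] anti[of "ax 3" "ax 1"] anti[of "ax 3" "ax 2"]
  \<comment> \<open>Expand in coordinates; only the alternating terms survive.\<close>
  have "\<beta> p [u, v] = \<beta> p [u $ 1 *\<^sub>R ax 1 + u $ 2 *\<^sub>R ax 2 + u $ 3 *\<^sub>R ax 3,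
      v $ 1 *\<^sub>R ax 1 + v $ 2 *\<^sub>R ax 2 + v $ 3 *\<^sub>R ax 3]"
    using axis3_expansion[of u] axis3_expansion[of v] by simp
  also have "\<dots> = flux \<beta> p \<bullet> cross3 u v"
    unfolding lin by (simp add: alt a flux_def cross3_def inner_vec_def sum_3 algebra_simps)
  finally show ?thesis .
qed

lemma form_smooth: "\<omega> \<in> forms k \<Longrightarrow> smooth (\<lambda>p. \<omega> p vs)"
  and form_periodic: "\<omega> \<in> forms k \<Longrightarrow> periodic3 (\<lambda>p. \<omega> p vs)"
  unfolding forms_def by blast+

lemma pd_current_eq: "pd_current \<alpha> \<beta> = torus_integral (\<lambda>p. flux \<beta> p \<bullet> \<alpha> (p $ 3))"
  unfolding pd_current_def form_integral_def
  by (simp add: wedge1_def covector_form_def flux_def omit_nth_def inner_vec_def sum_3 ax_nth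
      numeral_eq_Suc algebra_simps)

text \<open>
  Continuity only needs the uniform convergence of the coefficients themselves, not that of their
  derivatives.
\<close>

lemma integral_current:
  assumes J: "finite J" and c: "\<And>j. j \<in> J \<Longrightarrow> continuous_on UNIV (c j)"
  shows "(\<lambda>\<omega>. torus_integral (\<lambda>p. \<Sum>j\<in>J. c j p * \<omega> p (V j))) \<in> currents k"
proof -
  have cont: "continuous_on UNIV (\<lambda>p. c j p * \<omega> p vs)" if "j \<in> J" "\<omega> \<in> forms k" for j \<omega> vs
    by (intro continuous_on_mult c that(1) smooth_continuous_on form_smooth[OF that(2)])
  have eq: "torus_integral (\<lambda>p. \<Sum>j\<in>J. c j p * \<omega> p (V j))
      = (\<Sum>j\<in>J. torus_integral (\<lambda>p. c j p * \<omega> p (V j)))" if "\<omega> \<in> forms k" for \<omega>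
    by (intro torus_integral_sum J cont that)
  have lim: "(\<lambda>n. torus_integral (\<lambda>p. c j p * \<omega>s n p vs)) \<longlonglongrightarrow> torus_integral (\<lambda>p. c j p * \<omega> p vs)"
    if j: "j \<in> J" and \<omega>s: "\<And>n. \<omega>s n \<in> forms k" and \<omega>: "\<omega> \<in> forms k"
      and conv: "forms_converge \<omega>s \<omega>" for j \<omega>s \<omega> vs
  proof -
    have "uniform_limit UNIV (\<lambda>n. dirderivs [] (\<lambda>p. \<omega>s n p vs)) (dirderivs [] (\<lambda>p. \<omega> p vs)) sequentially"
      using conv unfolding forms_converge_def by blast
    then have u: "uniform_limit (cbox 0 1) (\<lambda>n p. \<omega>s n p vs) (\<lambda>p. \<omega> p vs) sequentially"
      by (auto intro: uniform_limit_on_subset)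
    have bdd: "bounded (h ` cbox 0 (1::real^3))" if "continuous_on UNIV h" for h :: "real^3 \<Rightarrow> real"
      using that by (intro compact_imp_bounded compact_continuous_image compact_cbox)
        (auto intro: continuous_on_subset)
    have "uniform_limit (cbox 0 1) (\<lambda>n p. c j p * \<omega>s n p vs) (\<lambda>p. c j p * \<omega> p vs) sequentially"
      by (intro uniform_lim_mult u uniform_limit_const bdd c j smooth_continuous_on form_smooth[OF \<omega>])
    then obtain I L where I: "\<And>n. ((\<lambda>p. c j p * \<omega>s n p vs) has_integral I n) (cbox 0 1)"
      and L: "((\<lambda>p. c j p * \<omega> p vs) has_integral L) (cbox 0 1)" and "I \<longlonglongrightarrow> L"
      by (rule uniform_limit_integral_cbox) (auto intro: continuous_on_subset[OF cont[OF j \<omega>s]])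
    then show ?thesis
      unfolding torus_integral_def integral_unique[OF I] integral_unique[OF L] by simp
  qed
  show ?thesis
    unfolding currents_def
  proof (intro CollectI conjI ballI allI impI)
    fix \<omega> \<eta> assume *: "\<omega> \<in> forms k" "\<eta> \<in> forms k"
    then show "torus_integral (\<lambda>p. \<Sum>j\<in>J. c j p * (\<omega> p (V j) + \<eta> p (V j)))
      = torus_integral (\<lambda>p. \<Sum>j\<in>J. c j p * \<omega> p (V j)) + torus_integral (\<lambda>p. \<Sum>j\<in>J. c j p * \<eta> p (V j))"
      unfolding distrib_left sum.distrib
      by (intro torus_integral_add continuous_on_sum cont) auto
  next
    fix a \<omega>
    show "torus_integral (\<lambda>p. \<Sum>j\<in>J. c j p * (a * \<omega> p (V j)))
      = a * torus_integral (\<lambda>p. \<Sum>j\<in>J. c j p * \<omega> p (V j))"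
      unfolding torus_integral_cmult[symmetric] by (simp add: sum_distrib_left mult.left_commute)
  next
    fix \<omega>s \<omega> assume *: "\<omega> \<in> forms k" "(\<forall>n. \<omega>s n \<in> forms k) \<and> forms_converge \<omega>s \<omega>"
    then show "(\<lambda>n. torus_integral (\<lambda>p. \<Sum>j\<in>J. c j p * \<omega>s n p (V j)))
        \<longlonglongrightarrow> torus_integral (\<lambda>p. \<Sum>j\<in>J. c j p * \<omega> p (V j))"
      by (auto simp: eq intro!: tendsto_sum lim)
  qed
qed

lemma smooth_loop_component: "smooth_loop \<alpha> \<Longrightarrow> smooth (\<lambda>t. \<alpha> t $ i)"
  and smooth_loop_periodic: "smooth_loop \<alpha> \<Longrightarrow> \<alpha> (t + 1) = \<alpha> t"
  by (auto simp: smooth_loop_def)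

lemma pd_current_in_currents:
  assumes "smooth_loop \<alpha>"
  shows "pd_current \<alpha> \<in> currents 2"
proof -
  define V :: "3 \<Rightarrow> (real^3) list" where
    "V j = (if j = 1 then [ax 2, ax 3] else if j = 2 then [ax 1, ax 3] else [ax 1, ax 2])" for j
  define c where "c j p = (if j = 2 then - 1 else 1) * \<alpha> (p $ 3) $ j" for j :: 3 and p :: "real^3"
  have "pd_current \<alpha> = (\<lambda>\<omega>. torus_integral (\<lambda>p. \<Sum>j\<in>UNIV. c j p * \<omega> p (V j)))"
    by (simp add: pd_current_eq[abs_def] fun_eq_iff flux_def inner_vec_def sum_3 V_def c_def algebra_simps)
  moreover have "continuous_on UNIV (c j)" for j
    unfolding c_def
    by (intro smooth_continuous_on smooth_mult smooth_const smooth_lift[OF smooth_loop_component] assms)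
  ultimately show ?thesis using integral_current[of UNIV c V] by simp
qed

text \<open>
  After integration by parts the derivative falls on the coefficient, which depends on \<open>t\<close> only:
  it survives solely if \<open>i = 3\<close> and the coefficient is not constant.
\<close>

lemma torus_integral_lift_dirderiv_form:
  assumes "smooth_loop \<alpha>" and "\<omega> \<in> forms k" and "i \<noteq> 3 \<or> (\<forall>t. \<alpha> t $ j = \<alpha> 0 $ j)"
  shows "torus_integral (\<lambda>p. \<alpha> (p $ 3) $ j * dirderiv (ax i) (\<lambda>p. \<omega> p vs) p) = 0"
proof -
  have zero: "(ax i) $ 3 * dirderiv 1 (\<lambda>t. \<alpha> t $ j) t = 0" for t
  proof (cases "i = 3")
    case True
    then have "\<alpha> t $ j = \<alpha> 0 $ j" for t using assms(3) by auto
    then show ?thesis by (simp add: dirderiv_constant[of "\<lambda>t. \<alpha> t $ j" "\<alpha> 0 $ j"])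
  qed (simp add: axis_def)
  have "torus_integral (\<lambda>p. \<alpha> (p $ 3) $ j * dirderiv (ax i) (\<lambda>p. \<omega> p vs) p)
      = - torus_integral (\<lambda>p. (ax i) $ 3 * dirderiv 1 (\<lambda>t. \<alpha> t $ j) (p $ 3) * \<omega> p vs)"
    using smooth_loop_component[OF assms(1)] smooth_loop_periodic[OF assms(1)]
      form_smooth[OF assms(2)] form_periodic[OF assms(2)]
    by (intro torus_integral_by_parts) auto
  then show ?thesis
    unfolding zero by (simp add: torus_integral_def)
qed

text \<open>
  The components of \<open>dx\<close> and \<open>dy\<close> have to be constant: this is closedness of the 1-form.
\<close>

lemma pd_current_closed:
  assumes \<alpha>: "smooth_loop \<alpha>" and const: "\<And>t. \<alpha> t $ 1 = \<alpha> 0 $ 1" "\<And>t. \<alpha> t $ 2 = \<alpha> 0 $ 2"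
  shows "pd_current \<alpha> \<in> closed_currents 2"
proof -
  have "bdry (pd_current \<alpha>) \<eta> = 0" if \<eta>: "\<eta> \<in> forms 1" for \<eta>
  proof -
    let ?D = "\<lambda>i j p. dirderiv (ax i) (\<lambda>p. \<eta> p [ax j]) p"
    let ?I = "\<lambda>k i j. torus_integral (\<lambda>p. \<alpha> (p $ 3) $ k * ?D i j p)"
    have cont: "continuous_on UNIV (\<lambda>p. \<alpha> (p $ 3) $ k * ?D i j p)" for k i j
      by (intro smooth_continuous_on smooth_mult smooth_lift[OF smooth_loop_component[OF \<alpha>]]
          smooth_dirderiv form_smooth[OF \<eta>])
    have "bdry (pd_current \<alpha>) \<eta> = torus_integral (\<lambda>p.
        (\<alpha> (p $ 3) $ 1 * ?D 2 3 p - \<alpha> (p $ 3) $ 1 * ?D 3 2 p)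
        - (\<alpha> (p $ 3) $ 2 * ?D 1 3 p - \<alpha> (p $ 3) $ 2 * ?D 3 1 p)
        + (\<alpha> (p $ 3) $ 3 * ?D 1 2 p - \<alpha> (p $ 3) $ 3 * ?D 2 1 p))"
      by (simp add: bdry_def pd_current_eq flux_def ext_deriv_def omit_nth_def inner_vec_def sum_3
          numeral_eq_Suc algebra_simps)
    also have "\<dots> = (?I 1 2 3 - ?I 1 3 2) - (?I 2 1 3 - ?I 2 3 1) + (?I 3 1 2 - ?I 3 2 1)"
      by (simp only: torus_integral_add torus_integral_diff cont continuous_on_add continuous_on_diff)
    also have "\<dots> = 0"
      using const by (simp add: torus_integral_lift_dirderiv_form[OF \<alpha> \<eta>])
    finally show ?thesis .
  qed
  then show ?thesis
    using pd_current_in_currents[OF \<alpha>] by (simp add: closed_currents_def)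
qed

text \<open>
  If the \<open>dt\<close>-components have the same mean, the two 1-forms differ by the differential of a
  function \<open>F(t)\<close> on the torus, and \<open>\<gamma> \<mapsto> - \<integral> F \<gamma>\<close> is a 3-current between the two 2-currents.
\<close>

lemma pd_current_homologous:
  assumes \<alpha>: "smooth_loop \<alpha>" and \<alpha>': "smooth_loop \<alpha>'"
    and const: "\<And>t. \<alpha> t $ 1 = \<alpha> 0 $ 1" "\<And>t. \<alpha> t $ 2 = \<alpha> 0 $ 2"
    and eq: "\<And>t. \<alpha>' t $ 1 = \<alpha> t $ 1" "\<And>t. \<alpha>' t $ 2 = \<alpha> t $ 2"
    and int: "integral {0..1} (\<lambda>t. \<alpha>' t $ 3 - \<alpha> t $ 3) = 0"
  shows "(pd_current \<alpha>, pd_current \<alpha>') \<in> homologous 2"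
proof -
  have f: "smooth (\<lambda>t. \<alpha>' t $ 3 - \<alpha> t $ 3)"
    by (intro smooth_diff smooth_loop_component \<alpha> \<alpha>')
  obtain F where F: "smooth F" "\<And>t. dirderiv 1 F t = \<alpha>' t $ 3 - \<alpha> t $ 3" "\<And>t. F (t + 1) = F t"
    using smooth_periodic_antiderivative[OF f] int smooth_loop_periodic[OF \<alpha>]
      smooth_loop_periodic[OF \<alpha>'] by auto
  define S :: current where
    "S = (\<lambda>\<gamma>. torus_integral (\<lambda>p. \<Sum>j\<in>{()}. - F (p $ 3) * \<gamma> p [ax 1, ax 2, ax 3]))"
  have contF: "continuous_on UNIV (\<lambda>p::real^3. - F (p $ 3))"
    by (intro smooth_continuous_on smooth_minus smooth_lift F)
  have S: "S \<in> currents (Suc 2)"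
    unfolding S_def by (intro integral_current contF) simp
  have "pd_current \<alpha>' \<beta> - pd_current \<alpha> \<beta> = bdry S \<beta>" if \<beta>: "\<beta> \<in> forms 2" for \<beta>
  proof -
    let ?D = "\<lambda>i vs p. dirderiv (ax i) (\<lambda>p. \<beta> p vs) p"
    have parts: "torus_integral (\<lambda>p. F (p $ 3) * ?D i vs p)
        = - torus_integral (\<lambda>p. (ax i) $ 3 * (\<alpha>' (p $ 3) $ 3 - \<alpha> (p $ 3) $ 3) * \<beta> p vs)" for i vs
      using torus_integral_by_parts[OF F(1) F(3) form_smooth[OF \<beta>] form_periodic[OF \<beta>]]
      by (simp add: F(2))
    have cont: "continuous_on UNIV (\<lambda>p. F (p $ 3) * ?D i vs p)" for i vs
      by (intro smooth_continuous_on smooth_mult smooth_lift F smooth_dirderiv form_smooth[OF \<beta>])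
    have c: "continuous_on UNIV (\<lambda>p. flux \<beta> p \<bullet> \<alpha> (p $ 3))" if "smooth_loop \<alpha>" for \<alpha>
      unfolding inner_vec_def inner_real_def sum_3 flux_def vector_3
      by (intro smooth_continuous_on smooth_add smooth_mult smooth_minus form_smooth[OF \<beta>]
          smooth_lift[OF smooth_loop_component] that)
    have "bdry S \<beta> = (-1) * torus_integral (\<lambda>p. F (p $ 3) * ?D 1 [ax 2, ax 3] p
        - F (p $ 3) * ?D 2 [ax 1, ax 3] p + F (p $ 3) * ?D 3 [ax 1, ax 2] p)"
      unfolding torus_integral_cmult[symmetric]
      by (simp add: bdry_def S_def ext_deriv_def omit_nth_def numeral_eq_Suc algebra_simps)
    also have "\<dots> = torus_integral (\<lambda>p. (\<alpha>' (p $ 3) $ 3 - \<alpha> (p $ 3) $ 3) * \<beta> p [ax 1, ax 2])"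
      by (simp add: torus_integral_add torus_integral_diff cont continuous_on_add continuous_on_diff
          parts) (simp add: axis_def torus_integral_def)
    also have "\<dots> = torus_integral (\<lambda>p. flux \<beta> p \<bullet> \<alpha>' (p $ 3) - flux \<beta> p \<bullet> \<alpha> (p $ 3))"
      by (simp add: flux_def inner_vec_def sum_3 eq algebra_simps)
    also have "\<dots> = pd_current \<alpha>' \<beta> - pd_current \<alpha> \<beta>"
      unfolding pd_current_eq by (intro torus_integral_diff c \<alpha> \<alpha>')
    finally show ?thesis by simp
  qed
  with S show ?thesis
    using pd_current_closed[OF \<alpha> const] pd_current_closed[OF \<alpha>'] const eq
    by (auto simp: homologous_def)
qed

lemma flux_form_in_forms:
  assumes W: "smooth_loop W"
  shows "flux_form W \<in> forms 2"
proof -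
  have two: "\<exists>u v. vs = [u, v]" if "length vs = 2" for vs :: "(real^3) list"
    using that by (auto simp: numeral_eq_Suc length_Suc_conv)
  have zero: "flux_form W p vs = 0" if "length vs \<noteq> 2" for p vs
    using that by (auto simp: flux_form_def split: list.split)
  have "smooth (\<lambda>p. flux_form W p vs)" for vs
  proof (cases "length vs = 2")
    case True
    then obtain u v where "vs = [u, v]" using two by blast
    then show ?thesis
      unfolding flux_form_def
      by (simp add: inner_vec_def) (intro smooth_sum smooth_mult smooth_const smooth_lift[OF smooth_loop_component[OF W]])
  qed (simp add: zero smooth_const)
  moreover have "linear (\<lambda>v. flux_form W p (vs[i := v]))" if "length vs = 2" "i < 2" for p vs i
    using two[OF that(1)] that(2)
    by (auto simp: flux_form_def less_2_cases_iff cross_add_left cross_add_right cross_mult_left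
        cross_mult_right inner_add_right intro!: linearI)
  moreover have "flux_form W p vs = 0" if "length vs = 2" "i < j" "j < 2" "vs ! i = vs ! j" for p vs i j
    using two[OF that(1)] that(2-) by (auto simp: flux_form_def less_2_cases_iff)
  moreover have "periodic3 (\<lambda>p. flux_form W p vs)" for vs
    unfolding flux_form_def
    by (rule periodic3_lift[of "\<lambda>t. case vs of [u, v] \<Rightarrow> W t \<bullet> cross3 u v | _ \<Rightarrow> 0"])
      (simp add: smooth_loop_periodic[OF W] split: list.split)
  ultimately show ?thesis using zero unfolding forms_def by blast
qed

lemma flux_flux_form: "flux (flux_form W) p = W (p $ 3)"
  by (simp add: flux_def flux_form_def vec_eq_iff forall_3 cross3_def axis_def inner_vec_def sum_3)

text \<open>
  The exterior derivative of the flux form is the divergence of the vector field, and only the third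
  component would contribute to it.
\<close>

lemma ext_deriv_flux_form:
  assumes W: "smooth_loop W" and const: "\<And>t. W t $ 3 = W 0 $ 3"
  shows "ext_deriv (flux_form W) = (\<lambda>p vs. 0)"
proof (intro ext)
  fix p vs
  show "ext_deriv (flux_form W) p vs = 0"
  proof (cases "length vs = 3")
    case True
    then obtain u v w where vs: "vs = [u, v, w]"
      by (auto simp: numeral_eq_Suc length_Suc_conv)
    define W' where "W' i = dirderiv 1 (\<lambda>t. W t $ i) (p $ 3)" for i
    have W'3: "W' 3 = 0" unfolding W'_def by (rule dirderiv_constant[OF const])
    have d: "dirderiv x (\<lambda>p. flux_form W p [y, z]) p
        = x $ 3 * (W' 1 * cross3 y z $ 1 + W' 2 * cross3 y z $ 2)" for x y z
    proof -
      have "((\<lambda>p. W (p $ 3) $ i * cross3 y z $ i) has_derivative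
          (\<lambda>x. (x $ 3 * W' i) * cross3 y z $ i)) (at p)" for i
        unfolding W'_def
        by (intro has_derivative_mult_left has_derivative_smooth_compose
            smooth_loop_component[OF W] bounded_linear_vec_nth)
      then have "((\<lambda>p. \<Sum>i\<in>UNIV. W (p $ 3) $ i * cross3 y z $ i) has_derivative
          (\<lambda>x. \<Sum>i\<in>UNIV. (x $ 3 * W' i) * cross3 y z $ i)) (at p)"
        by (intro has_derivative_sum)
      then have "((\<lambda>p. flux_form W p [y, z]) has_derivative
          (\<lambda>x. \<Sum>i\<in>UNIV. (x $ 3 * W' i) * cross3 y z $ i)) (at p)"
        by (simp add: flux_form_def inner_vec_def)
      from dirderiv_eqI[OF this, of x] show ?thesis by (simp add: sum_3 W'3 algebra_simps)
    qed
    have "ext_deriv (flux_form W) p vs = dirderiv u (\<lambda>p. flux_form W p [v, w]) p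
        - dirderiv v (\<lambda>p. flux_form W p [u, w]) p + dirderiv w (\<lambda>p. flux_form W p [u, v]) p"
      by (simp add: ext_deriv_def vs omit_nth_def numeral_eq_Suc)
    then show ?thesis unfolding d by (simp add: cross3_def algebra_simps)
  next
    case False
    have "flux_form W q (omit_nth i vs) = 0" if "i < length vs" for q i
    proof -
      have "length (omit_nth i vs) \<noteq> 2" using that False by (simp add: omit_nth_def)
      then show ?thesis by (auto simp: flux_form_def split: list.split)
    qed
    then show ?thesis unfolding ext_deriv_def by (intro sum.neutral ballI) (simp add: dirderiv_constant)
  qed
qed

section \<open>Calibrations\<close>

text \<open>
  Complete \<open>N\<close> to an oriented orthonormal basis. In three dimensions every 2-vector is therefore
  simple, which is why the comass is a Euclidean norm.
\<close>

lemma unit_vector_is_cross: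
  fixes N :: "real^3"
  assumes "norm N = 1"
  obtains u v where "norm u = 1" "norm v = 1" "u \<bullet> v = 0" "cross3 u v = N"
proof -
  have "2 \<le> DIM(real^3)" by simp
  then obtain y where y: "y \<noteq> 0" "orthogonal N y"
    using orthogonal_to_vector_exists[of N] by blast
  define u where "u = y /\<^sub>R norm y"
  have u: "norm u = 1" "N \<bullet> u = 0"
    using y by (auto simp: u_def orthogonal_def)
  \<comment> \<open>So \<open>u\<close> and \<open>cross3 N u\<close> are the required pair.\<close>
  have "cross3 u (cross3 N u) = N"
    using u assms by (simp add: Lagrange inner_commute dot_square_norm)
  moreover have "norm (cross3 N u) = 1"
    using norm_cross_dot[of N u] u assms by (simp add: power2_eq_1_iff) (use norm_ge_zero in \<open>smt\<close>)
  moreover have "u \<bullet> cross3 N u = 0" by (rule dot_cross_self)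
  ultimately show thesis using that u by blast
qed

text \<open>
  The cofactor rule for cross products transfers covectors from \<open>g = B\<^sup>T B\<close> to the Euclidean metric.
\<close>

lemma flux_cross_transform:
  fixes B :: "real^3^3"
  shows "det B * (Z \<bullet> cross3 u v) = (B *v Z) \<bullet> cross3 (B *v u) (B *v v)"
proof -
  have "(B *v Z) \<bullet> cross3 (B *v u) (B *v v) = (transpose B *v cross3 (B *v u) (B *v v)) \<bullet> Z"
    by (simp only: transpose_matrix_vector dot_lmul_matrix) (rule inner_commute)
  also have "\<dots> = det B * (Z \<bullet> cross3 u v)"
    unfolding cross_matrix_mult by (simp add: inner_commute)
  finally show ?thesis by simp
qed

lemma comass_le_one_iff:
  fixes B :: "real^3^3"
  assumes inner: "\<And>u v. inner_at g p u v = (B *v u) \<bullet> (B *v v)" and B: "det B > 0"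
    and \<phi>: "\<And>u v. \<phi> [u, v] = Z \<bullet> cross3 u v"
  shows "comass g p 2 \<phi> \<le> 1 \<longleftrightarrow> norm (B *v Z) \<le> det B"
proof
  assume le: "comass g p 2 \<phi> \<le> 1"
  show "norm (B *v Z) \<le> det B"
  proof (cases "B *v Z = 0")
    case False
    \<comment> \<open>The frame orthogonal to \<open>B Z\<close>, pulled back by \<open>B\<close>, realises the comass.\<close>
    define N where "N = (B *v Z) /\<^sub>R norm (B *v Z)"
    have "norm N = 1" using False by (simp add: N_def)
    then obtain u v where uv: "norm u = 1" "norm v = 1" "u \<bullet> v = 0" "cross3 u v = N"
      by (rule unit_vector_is_cross)
    obtain B' where B': "B ** B' = mat 1"
      using B invertible_det_nz[of B] by (auto simp: invertible_def)
    have BB': "B *v (B' *v w) = w" for w by (simp add: matrix_vector_mul_assoc B')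
    have "[B' *v u, B' *v v] \<in> orthonormal_frames g p 2"
      using uv by (auto simp: orthonormal_frames_def inner BB' less_2_cases_iff dot_square_norm
          inner_commute)
    then have "ereal \<bar>\<phi> [B' *v u, B' *v v]\<bar> \<le> comass g p 2 \<phi>"
      unfolding comass_def by (rule SUP_upper)
    with le have "\<bar>\<phi> [B' *v u, B' *v v]\<bar> \<le> 1"
      using order_trans by (fastforce simp: one_ereal_def)
    moreover have "det B * \<phi> [B' *v u, B' *v v] = norm (B *v Z)"
      unfolding \<phi> flux_cross_transform BB' uv(4) N_def by (simp add: dot_square_norm power2_eq_square field_simps)
    ultimately have "norm (B *v Z) \<le> det B * 1"
      using B by (metis abs_le_D1 mult_le_cancel_left_pos)
    then show ?thesis by simp
  qed (use B in simp)
next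
  assume le: "norm (B *v Z) \<le> det B"
  show "comass g p 2 \<phi> \<le> 1"
    unfolding comass_def
  proof (rule SUP_least)
    fix vs assume vs: "vs \<in> orthonormal_frames g p 2"
    then obtain u v where uv: "vs = [u, v]"
      by (auto simp: orthonormal_frames_def numeral_eq_Suc length_Suc_conv)
    have on: "(B *v vs ! i) \<bullet> (B *v vs ! j) = (if i = j then 1 else 0)" if "i < 2" "j < 2" for i j
      using vs that by (simp add: orthonormal_frames_def inner)
    have "(norm (cross3 (B *v u) (B *v v)))\<^sup>2 = 1"
      using norm_cross_dot[of "B *v u" "B *v v"] on[of 0 0] on[of 1 1] on[of 0 1]
      by (simp add: uv norm_eq_sqrt_inner)
    then have "norm (cross3 (B *v u) (B *v v)) = 1"
      by (simp add: power2_eq_1_iff) (smt (verit) norm_ge_zero)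
    then have "\<bar>det B * \<phi> vs\<bar> \<le> det B"
      using le Cauchy_Schwarz_ineq2[of "B *v Z" "cross3 (B *v u) (B *v v)"]
      unfolding uv \<phi> flux_cross_transform by simp
    then have "\<bar>\<phi> vs\<bar> \<le> 1" using B by (simp add: abs_mult)
    then show "ereal \<bar>\<phi> vs\<bar> \<le> 1" by (simp add: one_ereal_def)
  qed
qed

text \<open>
  The 2-form of \<open>W\<close> calibrates the current of \<open>\<alpha>\<close>. The hypothesis \<open>dual\<close> says that \<open>\<alpha>\<close> is \<open>s\<close>
  times the covector \<open>g(W, -)\<close>, written through the factor \<open>B\<close> of the metric.
\<close>

theorem stable_norm_calibration:
  fixes B :: "real^3 \<Rightarrow> real^3^3"
  assumes inner: "\<And>p u v. inner_at g p u v = (B p *v u) \<bullet> (B p *v v)"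
    and B: "\<And>p. det (B p) > 0"
    and \<alpha>: "smooth_loop \<alpha>" "\<And>t. \<alpha> t $ 1 = a" "\<And>t. \<alpha> t $ 2 = b" "integral {0..1} (\<lambda>t. \<alpha> t $ 3) = c"
    and W: "smooth_loop W" "\<And>t. W t $ 3 = W 0 $ 3" "\<And>p. norm (B p *v W (p $ 3)) = det (B p)"
    and dual: "\<And>p Z. \<alpha> (p $ 3) \<bullet> Z = s p * ((B p *v Z) \<bullet> (B p *v W (p $ 3)))" "\<And>p. s p \<ge> 0"
  shows "stable_norm g (r_class a b c) = ereal (integral {0..1} (\<lambda>t. W t \<bullet> vector [a, b, c]))"
proof -
  define \<alpha>\<^sub>0 :: "real \<Rightarrow> real^3" where "\<alpha>\<^sub>0 = (\<lambda>t. vector [a, b, c])"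
  define I where "I = integral {0..1} (\<lambda>t. W t \<bullet> vector [a, b, c])"
  have \<alpha>\<^sub>0: "smooth_loop \<alpha>\<^sub>0" by (simp add: smooth_loop_def \<alpha>\<^sub>0_def smooth_const)
  have r_class: "r_class a b c = homologous 2 `` {pd_current \<alpha>\<^sub>0}"
    by (simp add: r_class_def class_with_PD_def homology_class_def const_form1_eq \<alpha>\<^sub>0_def pd_current_def)
  have W2: "flux_form W \<in> forms 2" by (rule flux_form_in_forms[OF W(1)])
  have "comass g p 2 (flux_form W p) \<le> 1" for p
    by (subst comass_le_one_iff[OF inner B, of _ "W (p $ 3)"]) (simp_all add: flux_form_def eq_refl[OF W(3)])
  with W2 have admissible: "flux_form W \<in> {\<omega> \<in> forms 2. \<forall>p. comass g p 2 (\<omega> p) \<le> 1}" by simp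
  have "pd_current \<alpha>\<^sub>0 (flux_form W) = torus_integral (\<lambda>p. (\<lambda>t. W t \<bullet> vector [a, b, c]) (p $ 3))"
    by (simp add: pd_current_eq flux_flux_form \<alpha>\<^sub>0_def)
  also have "\<dots> = I"
    unfolding I_def
  proof (rule torus_integral_lift)
    show "smooth (\<lambda>t. W t \<bullet> vector [a, b, c])"
      unfolding inner_vec_def inner_real_def
      by (intro smooth_sum smooth_mult smooth_loop_component[OF W(1)] smooth_const)
  qed (simp add: smooth_loop_periodic[OF W(1)])
  finally have base: "pd_current \<alpha>\<^sub>0 (flux_form W) = I" .
  have calib: "T (flux_form W) = I" if T: "T \<in> r_class a b c" for T
  proof -
    obtain S where S: "S \<in> currents (Suc 2)"
      "\<And>\<omega>. \<omega> \<in> forms 2 \<Longrightarrow> T \<omega> - pd_current \<alpha>\<^sub>0 \<omega> = bdry S \<omega>"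
      using T unfolding r_class homologous_def Image_singleton_iff mem_Collect_eq case_prod_conv by blast
    have zero: "(\<lambda>p vs. 0) \<in> forms (Suc 2)"
      by (simp add: forms_def smooth_const periodic3_def linear_zero)
    have "\<And>x \<omega>. \<omega> \<in> forms (Suc 2) \<Longrightarrow> S (\<lambda>p vs. x * \<omega> p vs) = x * S \<omega>"
      using S(1) unfolding currents_def by blast
    \<comment> \<open>A current vanishes on the zero form by homogeneity.\<close>
    from this[OF zero, of 0] have "S (\<lambda>p vs. 0) = 0" by simp
    then have "bdry S (flux_form W) = 0"
      by (simp add: bdry_def ext_deriv_flux_form[OF W(1,2)])
    then show ?thesis using S(2)[OF W2] base by simp
  qed
  have lower: "ereal I \<le> mass g 2 T" if "T \<in> r_class a b c" for T
    unfolding mass_def calib[OF that, symmetric] by (rule SUP_upper[OF admissible])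
  have "integral {0..1} (\<lambda>t. \<alpha> t $ 3 - \<alpha>\<^sub>0 t $ 3) = 0"
    by (subst Henstock_Kurzweil_Integration.integral_diff)
      (auto simp: \<alpha>(4) \<alpha>\<^sub>0_def intro!: integrable_continuous_real
        smooth_continuous_on[OF smooth_loop_component[OF \<alpha>(1)]])
  then have mem: "pd_current \<alpha> \<in> r_class a b c"
    unfolding r_class using pd_current_homologous[OF \<alpha>\<^sub>0 \<alpha>(1)] by (simp add: \<alpha>\<^sub>0_def \<alpha>(2,3))
  have upper: "mass g 2 (pd_current \<alpha>) \<le> ereal I"
    unfolding mass_def
  proof (rule SUP_least)
    fix \<omega> assume "\<omega> \<in> {\<omega> \<in> forms 2. \<forall>p. comass g p 2 (\<omega> p) \<le> 1}"
    then have \<omega>: "\<omega> \<in> forms 2" and com: "\<And>p. comass g p 2 (\<omega> p) \<le> 1" by auto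
    have norm: "norm (B p *v flux \<omega> p) \<le> det (B p)" for p
      using com comass_le_one_iff[OF inner B forms_2_eq_flux[OF \<omega>]] by blast
    have cont: "continuous_on UNIV (\<lambda>p. flux \<beta> p \<bullet> \<alpha> (p $ 3))" if "\<beta> \<in> forms 2" for \<beta>
      unfolding inner_vec_def inner_real_def sum_3 flux_def vector_3
      by (intro smooth_continuous_on smooth_add smooth_mult smooth_minus form_smooth[OF that]
          smooth_lift[OF smooth_loop_component[OF \<alpha>(1)]])
    have le: "flux \<omega> p \<bullet> \<alpha> (p $ 3) \<le> flux (flux_form W) p \<bullet> \<alpha> (p $ 3)" for p
    proof -
      have "(B p *v flux \<omega> p) \<bullet> (B p *v W (p $ 3)) \<le> norm (B p *v flux \<omega> p) * det (B p)"
        using norm_cauchy_schwarz W(3) by metis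
      also have "\<dots> \<le> det (B p) * det (B p)"
        using norm B[of p] by (intro mult_right_mono) (auto intro: less_imp_le)
      also have "\<dots> = (B p *v W (p $ 3)) \<bullet> (B p *v W (p $ 3))"
        by (simp add: dot_square_norm W(3) power2_eq_square)
      finally show ?thesis
        unfolding flux_flux_form inner_commute[of _ "\<alpha> (p $ 3)"] dual(1)
        using dual(2) by (rule mult_left_mono)
    qed
    have "pd_current \<alpha> \<omega> \<le> pd_current \<alpha> (flux_form W)"
      unfolding pd_current_eq by (intro torus_integral_mono cont \<omega> W2 le)
    then show "ereal (pd_current \<alpha> \<omega>) \<le> ereal I" using calib[OF mem] by simp
  qed
  show ?thesis
    unfolding stable_norm_def I_def[symmetric]
  proof (rule antisym)
    show "(INF T\<in>r_class a b c. mass g 2 T) \<le> ereal I" by (rule order_trans[OF INF_lower[OF mem, of "mass g 2"] upper])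
    show "ereal I \<le> (INF T\<in>r_class a b c. mass g 2 T)" by (rule INF_greatest) (rule lower)
  qed
qed

section \<open>The frame of the metric, its volume density and its curvature\<close>

text \<open>
  The factor \<open>B\<close> with \<open>g = B\<^sup>T B\<close>, namely the square root \<open>diag(\<lambda>, 1/\<lambda>)\<close> of \<open>D\<^sub>\<lambda>\<close> times the
  rotation, completed by \<open>q\<close>.
\<close>

definition frame_matrix :: "real \<Rightarrow> (real \<Rightarrow> real) \<Rightarrow> real \<Rightarrow> real^3^3" where
  "frame_matrix lam q t = vector
     [vector [lam * cos (2 * pi * t), - lam * sin (2 * pi * t), 0],
      vector [sin (2 * pi * t) / lam, cos (2 * pi * t) / lam, 0],
      vector [0, 0, q t]]"

text \<open>
  The length of the covector \<open>a dx + b dy\<close> in the metric dual to \<open>h(t)\<close>: rotate \<open>(a, b)\<close> and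
  measure it with the inverse of \<open>D\<^sub>\<lambda>\<close>.
\<close>

definition dual_length :: "real \<Rightarrow> real \<Rightarrow> real \<Rightarrow> real \<Rightarrow> real" where
  "dual_length lam a b t = sqrt
     ((a * cos (2 * pi * t) - b * sin (2 * pi * t))\<^sup>2 / lam\<^sup>2
      + lam\<^sup>2 * (a * sin (2 * pi * t) + b * cos (2 * pi * t))\<^sup>2)"

lemma h_metric_components:
  assumes "lam > 0"
  shows "h_metric lam t $ 1 $ 1 = lam\<^sup>2 * (cos (2 * pi * t))\<^sup>2 + (sin (2 * pi * t))\<^sup>2 / lam\<^sup>2"
    and "h_metric lam t $ 1 $ 2 = (1 / lam\<^sup>2 - lam\<^sup>2) * sin (2 * pi * t) * cos (2 * pi * t)"
    and "h_metric lam t $ 2 $ 1 = (1 / lam\<^sup>2 - lam\<^sup>2) * sin (2 * pi * t) * cos (2 * pi * t)"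
    and "h_metric lam t $ 2 $ 2 = lam\<^sup>2 * (sin (2 * pi * t))\<^sup>2 + (cos (2 * pi * t))\<^sup>2 / lam\<^sup>2"
  by (simp_all add: h_metric_def matrix_matrix_mult_def transpose_def rot_mat_def diag_mat_def sum_2
      power_int_minus power2_eq_square field_simps)

lemma g_metric_factorization:
  assumes "lam > 0"
  shows "g_metric lam q p = transpose (frame_matrix lam q (p $ 3)) ** frame_matrix lam q (p $ 3)"
  using assms
  by (simp add: vec_eq_iff forall_3 g_metric_def Let_def frame_matrix_def matrix_matrix_mult_def
      transpose_def sum_3 h_metric_components power2_eq_square field_simps)

lemma inner_at_g_metric:
  assumes "lam > 0"
  shows "inner_at (g_metric lam q) p u v
    = (frame_matrix lam q (p $ 3) *v u) \<bullet> (frame_matrix lam q (p $ 3) *v v)"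
  unfolding inner_at_def g_metric_factorization[OF assms] matrix_vector_mul_assoc[symmetric]
    transpose_matrix_vector
  by (metis dot_lmul_matrix inner_commute)

lemma det_frame_matrix:
  assumes "lam > 0"
  shows "det (frame_matrix lam q t) = q t"
proof -
  have "det (frame_matrix lam q t) = q t * ((cos (2 * pi * t))\<^sup>2 + (sin (2 * pi * t))\<^sup>2)"
    using assms by (simp add: det_3 frame_matrix_def power2_eq_square field_simps del: sin_cos_squared_add sin_cos_squared_add2 sin_cos_squared_add3)
  then show ?thesis by simp
qed

lemma det_g_metric: "lam > 0 \<Longrightarrow> det (g_metric lam q p) = (q (p $ 3))\<^sup>2"
  by (simp add: g_metric_factorization det_mul det_transpose det_frame_matrix power2_eq_square)

lemma smooth_scaled_id: "smooth (\<lambda>t :: real. c * t)"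
  by (rule smooth_linear) (rule bounded_linear_mult_right)

lemma smooth_g_metric:
  assumes "lam > 0" and "smooth q"
  shows "smooth (\<lambda>t. g_metric lam q (vector [0, 0, t]) $ i $ j)"
proof -
  have "\<forall>i j. smooth (\<lambda>t. g_metric lam q (vector [0, 0, t]) $ i $ j)"
    using assms(1)
    by (auto simp: forall_3 g_metric_def Let_def h_metric_components
      intro!: smooth_intros smooth_scaled_id assms)
  then show ?thesis by blast
qed

lemma g_metric_lift: "g_metric lam q p = g_metric lam q (vector [0, 0, p $ 3])"
  by (simp add: g_metric_def)

lemma sin_cos_period1:
  "cos (2 * pi * (t + 1)) = cos (2 * pi * t)" "sin (2 * pi * (t + 1)) = sin (2 * pi * t)"
  by (simp_all add: distrib_left)

lemma riemannian_g_metric: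
  assumes "lam > 0" and q: "smooth q" "\<And>t. q (t + 1) = q t" "\<And>t. q t > 0"
  shows "riemannian_metric (g_metric lam q)"
  unfolding riemannian_metric_def
proof (intro conjI allI impI)
  show "smooth (\<lambda>p. g_metric lam q p $ i $ j)" for i j
    using smooth_lift[OF smooth_g_metric[OF assms(1) q(1), of i j], where i = "3 :: 3"]
    by (simp flip: g_metric_lift)
  have "frame_matrix lam q (t + 1) = frame_matrix lam q t" for t
    by (simp add: frame_matrix_def sin_cos_period1 q(2))
  then show "periodic3 (g_metric lam q)"
    by (simp add: periodic3_def ax_nth g_metric_factorization[OF assms(1)])
  show "transpose (g_metric lam q p) = g_metric lam q p" for p
    by (simp add: g_metric_factorization[OF assms(1)] matrix_transpose_mul)
  show "inner_at (g_metric lam q) p v v > 0" if "v \<noteq> 0" for p v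
  proof -
    have "invertible (frame_matrix lam q (p $ 3))"
      using q(3)[of "p $ 3"] by (simp add: invertible_det_nz det_frame_matrix[OF assms(1)])
    then have "frame_matrix lam q (p $ 3) *v v \<noteq> 0"
      using that by (metis invertible_def matrix_left_invertible_ker)
    then show ?thesis by (simp add: inner_at_g_metric[OF assms(1)])
  qed
qed

lemma matrix_inv_eqI:
  fixes A :: "real^'n^'n"
  assumes "A ** A' = mat 1"
  shows "matrix_inv A = A'"
proof -
  have A': "A' ** A = mat 1" using assms matrix_left_right_inverse by blast
  show ?thesis
    unfolding matrix_inv_def
  proof (rule some_equality)
    fix X assume "A ** X = mat 1 \<and> X ** A = mat 1"
    then show "X = A'" by (metis A' matrix_mul_assoc matrix_mul_lid matrix_mul_rid)
  qed (use assms A' in simp)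
qed

lemma matrix_inv_g_metric:
  assumes "lam > 0" and q: "q (p $ 3) > 0"
  defines "h \<equiv> h_metric lam (p $ 3)"
  shows "matrix_inv (g_metric lam q p) = vector
     [vector [h $ 2 $ 2, - h $ 1 $ 2, 0], vector [- h $ 1 $ 2, h $ 1 $ 1, 0],
      vector [0, 0, 1 / (q (p $ 3))\<^sup>2]]"
proof (rule matrix_inv_eqI)
  define C S where "C = cos (2 * pi * (p $ 3))" and "S = sin (2 * pi * (p $ 3))"
  have h: "h $ 1 $ 1 = lam\<^sup>2 * C\<^sup>2 + S\<^sup>2 / lam\<^sup>2" "h $ 1 $ 2 = (1 / lam\<^sup>2 - lam\<^sup>2) * S * C"
    "h $ 2 $ 1 = (1 / lam\<^sup>2 - lam\<^sup>2) * S * C" "h $ 2 $ 2 = lam\<^sup>2 * S\<^sup>2 + C\<^sup>2 / lam\<^sup>2"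
    unfolding h_def C_def S_def by (rule h_metric_components[OF assms(1)])+
  have "(lam\<^sup>2 * C\<^sup>2 + S\<^sup>2 / lam\<^sup>2) * (lam\<^sup>2 * S\<^sup>2 + C\<^sup>2 / lam\<^sup>2)
      - ((1 / lam\<^sup>2 - lam\<^sup>2) * S * C) * ((1 / lam\<^sup>2 - lam\<^sup>2) * S * C) = (C\<^sup>2 + S\<^sup>2)\<^sup>2"
    using assms(1) by (simp add: power2_eq_square field_simps)
  moreover have sym: "h $ 2 $ 1 = h $ 1 $ 2" unfolding h ..
  ultimately have "h $ 1 $ 1 * h $ 2 $ 2 - h $ 1 $ 2 * h $ 1 $ 2 = 1"
    unfolding h(1,2,4) by (simp add: C_def S_def)
  then show "g_metric lam q p ** vector
     [vector [h $ 2 $ 2, - h $ 1 $ 2, 0], vector [- h $ 1 $ 2, h $ 1 $ 1, 0],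
      vector [0, 0, 1 / (q (p $ 3))\<^sup>2]] = mat 1"
    using q sym
    by (simp add: vec_eq_iff forall_3 g_metric_def Let_def matrix_matrix_mult_def sum_3 mat_def
        h_def[symmetric] algebra_simps)
qed

text \<open>
  All Christoffel symbols are functions of \<open>t\<close>, so the derivative terms in the component
  \<open>R\<^sup>1\<^sub>2\<^sub>1\<^sub>2\<close> vanish. At \<open>t = 0\<close> the quadratic terms reduce to
  \<open>- \<Gamma>\<^sup>1\<^sub>2\<^sub>3 \<Gamma>\<^sup>3\<^sub>1\<^sub>2\<close>, because there \<open>h'\<close> has no diagonal entries.
\<close>

lemma not_flat_g_metric:
  assumes lam: "lam > 1" and q: "smooth q" "\<And>t. q t > 0"
  shows "\<not> flat (g_metric lam q)"
proof -
  have lam0: "lam > 0" using lam by simp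
  define \<gamma> where "\<gamma> t = g_metric lam q (vector [0, 0, t])" for t
  define \<gamma>' where "\<gamma>' i j t = dirderiv 1 (\<lambda>t. \<gamma> t $ i $ j) t" for i j t
  define G where "G t = matrix_inv (\<gamma> t)" for t
  define \<Gamma> where "\<Gamma> k i j t = (\<Sum>l\<in>UNIV. G t $ k $ l *
     ((ax i) $ 3 * \<gamma>' j l t + (ax j) $ 3 * \<gamma>' i l t - (ax l) $ 3 * \<gamma>' i j t)) / 2" for k i j t
  have \<gamma>: "smooth (\<lambda>t. \<gamma> t $ i $ j)" for i j
    unfolding \<gamma>_def by (rule smooth_g_metric[OF lam0 q(1)])
  have G: "G t = vector [vector [h_metric lam t $ 2 $ 2, - h_metric lam t $ 1 $ 2, 0],
      vector [- h_metric lam t $ 1 $ 2, h_metric lam t $ 1 $ 1, 0], vector [0, 0, 1 / (q t)\<^sup>2]]" for t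
    unfolding G_def \<gamma>_def by (subst matrix_inv_g_metric[OF lam0]) (simp_all add: q)
  have "\<forall>i j. smooth (\<lambda>t. G t $ i $ j)"
    using q(2) lam0 by (auto simp: G forall_3 h_metric_components[OF lam0] less_imp_neq[symmetric]
      intro!: smooth_intros smooth_scaled_id q(1))
  then have \<Gamma>: "smooth (\<Gamma> k i j)" for k i j
    unfolding \<Gamma>_def \<gamma>'_def
    by (intro smooth_divide smooth_sum smooth_mult smooth_add smooth_diff smooth_const
        smooth_dirderiv \<gamma>) auto
  have gp: "g_metric lam q p = \<gamma> (p $ 3)" for p
    unfolding \<gamma>_def by (rule g_metric_lift)
  have chr: "christoffel (g_metric lam q) k i j = (\<lambda>p. \<Gamma> k i j (p $ 3))" for k i j
    unfolding christoffel_def gp dirderiv_lift[OF \<gamma>] \<Gamma>_def G_def \<gamma>'_def ..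
  have R: "riemann_tensor (g_metric lam q) 1 2 1 2 0
      = (\<Sum>m\<in>UNIV. \<Gamma> 1 1 m 0 * \<Gamma> m 2 2 0 - \<Gamma> 1 2 m 0 * \<Gamma> m 1 2 0)"
    unfolding riemann_tensor_def chr dirderiv_lift[OF \<Gamma>] by (simp add: ax_nth)
  \<comment> \<open>The off-diagonal entry of \<open>h'(0)\<close>.\<close>
  define d where "d = 2 * pi * (1 / lam\<^sup>2 - lam\<^sup>2)"
  have der: "dirderiv 1 f t = D" if "(f has_real_derivative D) (at t)" for f t D
    using dirderiv_eqI[OF that[unfolded has_field_derivative_def], of 1] by simp
  have "((\<lambda>t. (1 / lam\<^sup>2 - lam\<^sup>2) * sin (2 * pi * t) * cos (2 * pi * t)) has_real_derivative d) (at 0)"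
    unfolding d_def by (auto intro!: derivative_eq_intros)
  then have g12: "\<gamma>' 1 2 0 = d" "\<gamma>' 2 1 0 = d"
    unfolding \<gamma>'_def \<gamma>_def by (auto simp: g_metric_def Let_def h_metric_components[OF lam0] intro!: der)
  have "((\<lambda>t. lam\<^sup>2 * (cos (2 * pi * t))\<^sup>2 + (sin (2 * pi * t))\<^sup>2 / lam\<^sup>2) has_real_derivative 0) (at 0)"
    by (rule derivative_eq_intros refl | use lam0 in simp)+
  then have g11: "\<gamma>' 1 1 0 = 0"
    unfolding \<gamma>'_def \<gamma>_def by (auto simp: g_metric_def Let_def h_metric_components[OF lam0] intro!: der)
  have "riemann_tensor (g_metric lam q) 1 2 1 2 0 = d\<^sup>2 / (4 * lam\<^sup>2 * (q 0)\<^sup>2)"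
    unfolding R
    by (simp add: sum_3 \<Gamma>_def ax_nth G h_metric_components[OF lam0] g12 g11 power2_eq_square)
  moreover have "d \<noteq> 0"
  proof -
    have "1 / lam\<^sup>2 < 1" "lam\<^sup>2 > 1" using lam by (simp_all add: one_less_power)
    then show ?thesis by (simp add: d_def)
  qed
  ultimately have "riemann_tensor (g_metric lam q) 1 2 1 2 0 \<noteq> 0"
    using q(2)[of 0] lam0 by simp
  then show ?thesis unfolding flat_def by blast
qed

section \<open>The stable norm\<close>

text \<open>
  Shifting by half a period replaces \<open>f\<close> by its complement to \<open>m\<close> and keeps \<open>w\<close>.
\<close>

lemma integral_half_period_average:
  fixes f w :: "real \<Rightarrow> real"
  assumes f: "continuous_on UNIV f" "\<And>t. f (t + 1) = f t"
    and w: "continuous_on UNIV w" "\<And>t. w (t + 1/2) = w t"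
    and sum: "\<And>t. f t + f (t + 1/2) = m"
  shows "integral {0..1} (\<lambda>t. f t * w t) = m / 2 * integral {0..1} w"
proof -
  have fw: "continuous_on UNIV (\<lambda>t. f t * w t)" by (intro continuous_on_mult f w)
  have per: "f (t + 1) * w (t + 1) = f t * w t" for t
    using w(2)[of t] w(2)[of "t + 1/2"] f(2)[of t] by (simp add: add.assoc)
  have fs: "continuous_on UNIV (\<lambda>t. f (t + 1/2))"
    by (rule continuous_on_compose2[OF f(1)]) (auto intro!: continuous_intros)
  have int: "g integrable_on {0..1}" if "continuous_on UNIV g" for g :: "real \<Rightarrow> real"
    using that by (intro integrable_continuous_real) (auto intro: continuous_on_subset)
  have "integral {0..1} (\<lambda>t. f (t + 1/2) * w t) = integral {0..1} (\<lambda>t. f t * w t)"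
    using integral_translate_periodic_real[OF fw per, of "1/2"] by (simp add: w(2))
  moreover have "integral {0..1} (\<lambda>t. f t * w t) + integral {0..1} (\<lambda>t. f (t + 1/2) * w t)
      = integral {0..1} (\<lambda>t. f t * w t + f (t + 1/2) * w t)"
    by (intro Henstock_Kurzweil_Integration.integral_add[symmetric] int continuous_on_mult f w fs)
  moreover have "f t * w t + f (t + 1/2) * w t = m * w t" for t
    unfolding distrib_right[symmetric] sum ..
  ultimately show ?thesis by simp
qed

lemma dual_length_positive:
  assumes "lam > 0" and "a\<^sup>2 + b\<^sup>2 > 0"
  shows "dual_length lam a b t > 0"
proof -
  define C S where "C = cos (2 * pi * t)" and "S = sin (2 * pi * t)"
  define X Y where "X = a * C - b * S" and "Y = a * S + b * C"
  have "X\<^sup>2 + Y\<^sup>2 = (a\<^sup>2 + b\<^sup>2) * (C\<^sup>2 + S\<^sup>2)"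
    by (simp add: X_def Y_def power2_eq_square algebra_simps)
  also have "\<dots> > 0" using assms(2) by (simp add: C_def S_def)
  finally have "X \<noteq> 0 \<or> Y \<noteq> 0" by auto
  then have "X\<^sup>2 / lam\<^sup>2 + lam\<^sup>2 * Y\<^sup>2 > 0"
    using assms(1) by (auto intro: add_pos_nonneg add_nonneg_pos)
  then show ?thesis by (simp add: dual_length_def X_def Y_def C_def S_def)
qed

lemma smooth_dual_length:
  assumes "lam > 0" and "a\<^sup>2 + b\<^sup>2 > 0"
  shows "smooth (dual_length lam a b)"
proof -
  have "0 < (a * cos (2 * pi * t) - b * sin (2 * pi * t))\<^sup>2 / lam\<^sup>2
      + lam\<^sup>2 * (a * sin (2 * pi * t) + b * cos (2 * pi * t))\<^sup>2" for t
    using dual_length_positive[OF assms, of t] by (simp add: dual_length_def)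
  then show ?thesis
    using assms(1) unfolding dual_length_def[abs_def]
    by (auto intro!: smooth_intros smooth_scaled_id)
qed

lemma dual_length_half_period: "dual_length lam a b (t + 1/2) = dual_length lam a b t"
proof -
  have "2 * pi * (t + 1/2) = 2 * pi * t + pi" by (simp add: distrib_left)
  then have "cos (2 * pi * (t + 1/2)) = - cos (2 * pi * t)"
    "sin (2 * pi * (t + 1/2)) = - sin (2 * pi * t)" by simp_all
  moreover have "(- x + y)\<^sup>2 = (x - y)\<^sup>2" "(- x - y)\<^sup>2 = (x + y)\<^sup>2" for x y :: real
    by (simp_all add: power2_eq_square algebra_simps)
  ultimately show ?thesis by (simp add: dual_length_def)
qed

text \<open>
  In polar coordinates for \<open>(a, b)\<close> the rotation \<open>R\<close> adds \<open>2 \<pi> t\<close> to the angle, so changing the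
  direction of \<open>(a, b)\<close> amounts to a translation in \<open>t\<close>.
\<close>

lemma integral_dual_length:
  assumes lam: "lam > 0" and ab: "a\<^sup>2 + b\<^sup>2 > 0"
  shows "integral {0..1} (dual_length lam a b) = sqrt (a\<^sup>2 + b\<^sup>2) * kappa lam"
proof -
  define r where "r = sqrt (a\<^sup>2 + b\<^sup>2)"
  have r: "r > 0" "r\<^sup>2 = a\<^sup>2 + b\<^sup>2" using ab by (simp_all add: r_def)
  have "(a / r)\<^sup>2 + (b / r)\<^sup>2 = 1"
    unfolding power_divide add_divide_distrib[symmetric] r(2)[symmetric] using r(1) by simp
  then obtain \<phi> where \<phi>: "0 \<le> \<phi>" "\<phi> < 2 * pi" "a / r = cos \<phi>" "b / r = sin \<phi>"
    using sincos_total_2pi by metis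
  have ab_eq: "a = r * cos \<phi>" "b = r * sin \<phi>" using \<phi>(3,4) r by (simp_all add: field_simps)
  have k: "dual_length lam 1 0 t = sqrt (lam powi -2 * (cos (2 * pi * t))^2 + lam^2 * (sin (2 * pi * t))^2)" for t
    by (simp add: dual_length_def power_int_minus field_simps)
  have "dual_length lam a b t = r * dual_length lam 1 0 (t + \<phi> / (2 * pi))" for t
  proof -
    have "2 * pi * (t + \<phi> / (2 * pi)) = 2 * pi * t + \<phi>" by (simp add: field_simps)
    moreover have "a * cos (2 * pi * t) - b * sin (2 * pi * t) = r * cos (2 * pi * t + \<phi>)"
      "a * sin (2 * pi * t) + b * cos (2 * pi * t) = r * sin (2 * pi * t + \<phi>)"
      by (simp_all add: ab_eq cos_add sin_add algebra_simps)
    ultimately have "dual_length lam a b t = sqrt (r\<^sup>2 * ((cos (2 * pi * t + \<phi>))\<^sup>2 / lam\<^sup>2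
        + lam\<^sup>2 * (sin (2 * pi * t + \<phi>))\<^sup>2))" and
      "dual_length lam 1 0 (t + \<phi> / (2 * pi)) = sqrt ((cos (2 * pi * t + \<phi>))\<^sup>2 / lam\<^sup>2
        + lam\<^sup>2 * (sin (2 * pi * t + \<phi>))\<^sup>2)"
      by (simp_all add: dual_length_def power_mult_distrib algebra_simps)
    then show ?thesis using r(1) by (simp only: real_sqrt_mult) simp
  qed
  then have "integral {0..1} (dual_length lam a b)
      = r * integral {0..1} (\<lambda>t. dual_length lam 1 0 (t + \<phi> / (2 * pi)))"
    by (simp add: fun_eq_iff[symmetric] cong: integral_cong)
  also have "integral {0..1} (\<lambda>t. dual_length lam 1 0 (t + \<phi> / (2 * pi)))
      = integral {0..1} (dual_length lam 1 0)"
    using \<phi>(1,2)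
    by (intro integral_translate_periodic_real smooth_continuous_on[OF smooth_dual_length[OF lam]])
      (auto simp: dual_length_def sin_cos_period1)
  also have "\<dots> = kappa lam" unfolding kappa_def k ..
  finally show ?thesis unfolding r_def .
qed

lemma frame_matrix_mult:
  "frame_matrix lam q t *v Z = vector
     [lam * (cos (2 * pi * t) * Z $ 1 - sin (2 * pi * t) * Z $ 2),
      (sin (2 * pi * t) * Z $ 1 + cos (2 * pi * t) * Z $ 2) / lam, q t * Z $ 3]"
  by (simp add: vec_eq_iff forall_3 frame_matrix_def matrix_vector_mult_def sum_3 algebra_simps
      add_divide_distrib)

text \<open>
  Multiples of the class of the torus fibre are calibrated by \<open>\<plusminus> dx \<and> dy\<close>.
\<close>

lemma stable_norm_g_metric_vertical:
  assumes lam: "lam > 0" and q: "smooth q" "\<And>t. q t > 0"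
  shows "stable_norm (g_metric lam q) (r_class 0 0 c) = ereal \<bar>c\<bar>"
proof -
  \<comment> \<open>The sign of \<open>c\<close>, with the value 1 at \<open>c = 0\<close> so that the comass is still 1.\<close>
  define \<epsilon> :: real where "\<epsilon> = (if c < 0 then -1 else 1)"
  have "stable_norm (g_metric lam q) (r_class 0 0 c)
      = ereal (integral {0..1} (\<lambda>t :: real. vector [0, 0, \<epsilon>] \<bullet> (vector [0, 0, c] :: real^3)))"
  proof (rule stable_norm_calibration[where B = "\<lambda>p. frame_matrix lam q (p $ 3)" and
        \<alpha> = "\<lambda>t. vector [0, 0, c]" and W = "\<lambda>t. vector [0, 0, \<epsilon>]" and
        s = "\<lambda>p. \<bar>c\<bar> / (q (p $ 3))\<^sup>2", OF inner_at_g_metric[OF lam]])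
    show "norm (frame_matrix lam q (p $ 3) *v vector [0, 0, \<epsilon>]) = det (frame_matrix lam q (p $ 3))" for p :: "real^3"
      using q(2)[of "p $ 3"]
      by (simp add: det_frame_matrix[OF lam] frame_matrix_mult norm_vec_def L2_set_def sum_3 \<epsilon>_def)
    show "vector [0, 0, c] \<bullet> Z = \<bar>c\<bar> / (q (p $ 3))\<^sup>2 *
      ((frame_matrix lam q (p $ 3) *v Z) \<bullet> (frame_matrix lam q (p $ 3) *v vector [0, 0, \<epsilon>]))" for p Z :: "real^3"
      using q(2)[of "p $ 3"]
      by (auto simp: frame_matrix_mult inner_vec_def sum_3 \<epsilon>_def power2_eq_square)
  qed (use q in \<open>auto simp: det_frame_matrix[OF lam] smooth_loop_def smooth_const\<close>)
  then show ?thesis by (simp add: inner_vec_def sum_3 \<epsilon>_def split: if_splits)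
qed

text \<open>
  The calibrating pair is \<open>\<alpha> = a dx + b dy + (c / r) q n dt\<close> and its \<open>g\<close>-dual \<open>W\<close>, scaled to
  have \<open>g\<close>-length \<open>det B = q\<close>. In the proof \<open>(X, Y)\<close> is the rotated covector \<open>(a, b)\<close>.
\<close>

lemma stable_norm_g_metric_oblique:
  assumes lam: "lam > 0" and q: "smooth q" "\<And>t. q (t + 1) = q t" "\<And>t. q t > 0"
    and sum: "\<And>t. q t + q (t + 1/2) = 2 / kappa lam" and ab: "a\<^sup>2 + b\<^sup>2 > 0"
  shows "stable_norm (g_metric lam q) (r_class a b c) = ereal (sqrt (a\<^sup>2 + b\<^sup>2 + c\<^sup>2))"
proof -
  define r R where "r = sqrt (a\<^sup>2 + b\<^sup>2)" and "R = sqrt (a\<^sup>2 + b\<^sup>2 + c\<^sup>2)"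
  have r: "r > 0" "r\<^sup>2 = a\<^sup>2 + b\<^sup>2" using ab by (simp_all add: r_def)
  have R: "R > 0" "R\<^sup>2 = r\<^sup>2 + c\<^sup>2" using ab by (simp_all add: R_def r_def add_pos_nonneg)
  define n where "n = dual_length lam a b"
  define C S where "C t = cos (2 * pi * t)" and "S t = sin (2 * pi * t)" for t :: real
  define X Y where "X t = a * C t - b * S t" and "Y t = a * S t + b * C t" for t
  have CS: "(C t)\<^sup>2 + (S t)\<^sup>2 = 1" for t by (simp add: C_def S_def)
  have n_pos: "n t > 0" for t unfolding n_def by (rule dual_length_positive[OF lam ab])
  have n_nz: "n t \<noteq> 0" for t using n_pos[of t] by simp
  have n_sq: "(n t)\<^sup>2 = (X t)\<^sup>2 / lam\<^sup>2 + lam\<^sup>2 * (Y t)\<^sup>2" for t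
    using n_pos[of t] by (simp add: n_def dual_length_def X_def Y_def C_def S_def)
  have n_smooth: "smooth n" unfolding n_def by (rule smooth_dual_length[OF lam ab])
  have n_half: "n (t + 1/2) = n t" for t unfolding n_def by (rule dual_length_half_period)
  have n_per: "n (t + 1) = n t" for t using n_half[of "t + 1/2"] n_half[of t] by (simp add: add.assoc)
  have "2 / kappa lam > 0" using sum[of 0] q(3)[of 0] q(3)[of "0 + 1/2"] by linarith
  then have kappa: "kappa lam > 0" by (simp add: zero_less_divide_iff)
  have qn: "integral {0..1} (\<lambda>t. q t * n t) = r"
    using integral_half_period_average[OF smooth_continuous_on[OF q(1)] q(2)
        smooth_continuous_on[OF n_smooth] n_half sum]
      integral_dual_length[OF lam ab] kappa by (simp add: n_def r_def)
  define \<alpha> :: "real \<Rightarrow> real^3" where "\<alpha> t = vector [a, b, c / r * (q t * n t)]" for t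
  define w where "w t = r / R * (q t / n t)" for t
  define W :: "real \<Rightarrow> real^3" where "W t = vector
    [w t * (C t * X t / lam\<^sup>2 + lam\<^sup>2 * (S t * Y t)),
     w t * (lam\<^sup>2 * (C t * Y t) - S t * X t / lam\<^sup>2), c / R]" for t
  have BW: "frame_matrix lam q t *v W t = vector [w t * X t / lam, w t * lam * Y t, q t * c / R]" for t
  proof -
    have "lam * (C t * W t $ 1 - S t * W t $ 2) = w t * X t / lam * ((C t)\<^sup>2 + (S t)\<^sup>2)"
      "(S t * W t $ 1 + C t * W t $ 2) / lam = w t * lam * Y t * ((C t)\<^sup>2 + (S t)\<^sup>2)"
      using lam by (simp_all add: W_def power2_eq_square field_simps)
    then show ?thesis
      unfolding frame_matrix_mult C_def[symmetric] S_def[symmetric] CS by (simp add: W_def)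
  qed
  have w_smooth: "smooth w"
    unfolding w_def by (intro smooth_mult smooth_divide smooth_const q n_smooth n_nz)
  have "smooth C" "smooth S"
    unfolding C_def S_def by (intro smooth_cos smooth_sin smooth_scaled_id)+
  note smooths = smooth_const smooth_mult smooth_add smooth_diff smooth_divide q(1) n_smooth w_smooth this
  have sX: "smooth X" and sY: "smooth Y"
    unfolding X_def Y_def by (intro smooths)+
  have pers: "C (t + 1) = C t" "S (t + 1) = S t" "w (t + 1) = w t" for t
    by (simp_all add: C_def S_def w_def sin_cos_period1 q(2) n_per)
  have "stable_norm (g_metric lam q) (r_class a b c)
      = ereal (integral {0..1} (\<lambda>t. W t \<bullet> vector [a, b, c]))"
  proof (rule stable_norm_calibration[where B = "\<lambda>p. frame_matrix lam q (p $ 3)" and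
        s = "\<lambda>p. n (p $ 3) * R / (r * q (p $ 3))", OF inner_at_g_metric[OF lam]])
    show "det (frame_matrix lam q (p $ 3)) > 0" for p :: "real^3"
      by (simp add: det_frame_matrix[OF lam] q(3))
    have "\<forall>i. smooth (\<lambda>t. \<alpha> t $ i)"
      using r(1) by (auto simp: forall_3 \<alpha>_def intro!: smooths)
    then show "smooth_loop \<alpha>" by (simp add: smooth_loop_def) (simp add: \<alpha>_def q(2) n_per)
    show "\<alpha> t $ 1 = a" "\<alpha> t $ 2 = b" for t by (simp_all add: \<alpha>_def)
    show "integral {0..1} (\<lambda>t. \<alpha> t $ 3) = c" using r(1) by (simp add: \<alpha>_def qn)
    have "\<forall>i. smooth (\<lambda>t. W t $ i)"
      using lam by (auto simp: forall_3 W_def intro!: smooths sX sY)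
    then show "smooth_loop W" by (simp add: smooth_loop_def) (simp add: W_def X_def Y_def pers)
    show "W t $ 3 = W 0 $ 3" for t by (simp add: W_def)
    show "norm (frame_matrix lam q (p $ 3) *v W (p $ 3)) = det (frame_matrix lam q (p $ 3))" for p :: "real^3"
    proof -
      define t where "t = p $ 3"
      have "(w t * X t / lam)\<^sup>2 + (w t * lam * Y t)\<^sup>2 + (q t * c / R)\<^sup>2
          = (w t)\<^sup>2 * ((X t)\<^sup>2 / lam\<^sup>2 + lam\<^sup>2 * (Y t)\<^sup>2) + (q t * c / R)\<^sup>2"
        by (simp add: power_mult_distrib power_divide algebra_simps)
      also have "\<dots> = (q t)\<^sup>2 * (r\<^sup>2 + c\<^sup>2) / R\<^sup>2"
        unfolding n_sq[symmetric] using n_nz[of t]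
        by (simp add: w_def power_mult_distrib power_divide add_divide_distrib algebra_simps)
      also have "\<dots> = (q t)\<^sup>2" unfolding R(2)[symmetric] using R(1) by simp
      finally have "norm (frame_matrix lam q t *v W t) = q t"
        unfolding BW using q(3)[of t] by (simp add: norm_vec_def L2_set_def sum_3)
      then show ?thesis by (simp add: t_def det_frame_matrix[OF lam])
    qed
    show "\<alpha> (p $ 3) \<bullet> Z = n (p $ 3) * R / (r * q (p $ 3)) *
      ((frame_matrix lam q (p $ 3) *v Z) \<bullet> (frame_matrix lam q (p $ 3) *v W (p $ 3)))" for p Z :: "real^3"
    proof -
      define t where "t = p $ 3"
      have "C t * X t + S t * Y t = a * ((C t)\<^sup>2 + (S t)\<^sup>2)" "C t * Y t - S t * X t = b * ((C t)\<^sup>2 + (S t)\<^sup>2)"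
        by (simp_all add: X_def Y_def power2_eq_square algebra_simps)
      then have rot: "C t * X t + S t * Y t = a" "C t * Y t - S t * X t = b" by (simp_all add: CS)
      have "(frame_matrix lam q t *v Z) \<bullet> (frame_matrix lam q t *v W t)
          = w t * ((C t * X t + S t * Y t) * Z $ 1 + (C t * Y t - S t * X t) * Z $ 2) + (q t)\<^sup>2 * c / R * Z $ 3"
        unfolding BW unfolding frame_matrix_mult C_def[symmetric] S_def[symmetric] using lam
        by (simp add: inner_vec_def sum_3 power2_eq_square field_simps)
      also have "\<dots> = w t * (a * Z $ 1 + b * Z $ 2) + (q t)\<^sup>2 * c / R * Z $ 3"
        unfolding rot ..
      finally show ?thesis
        unfolding t_def[symmetric] using r(1) R(1) n_pos[of t] q(3)[of t]
        by (simp add: \<alpha>_def inner_vec_def sum_3 w_def power2_eq_square field_simps)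
    qed
    show "n (p $ 3) * R / (r * q (p $ 3)) \<ge> 0" for p :: "real^3"
      using r(1) R(1) n_pos[of "p $ 3"] q(3)[of "p $ 3"] by simp
  qed
  also have "integral {0..1} (\<lambda>t. W t \<bullet> vector [a, b, c]) = R"
  proof -
    have "W t \<bullet> vector [a, b, c] = r / R * (q t * n t) + c\<^sup>2 / R" for t
    proof -
      have "W t \<bullet> vector [a, b, c] = w t * ((X t)\<^sup>2 / lam\<^sup>2 + lam\<^sup>2 * (Y t)\<^sup>2) + c\<^sup>2 / R"
        using lam by (simp add: W_def inner_vec_def sum_3 X_def Y_def power2_eq_square field_simps)
      also have "w t * ((X t)\<^sup>2 / lam\<^sup>2 + lam\<^sup>2 * (Y t)\<^sup>2) = r / R * (q t * n t)"
        unfolding n_sq[symmetric] using n_nz[of t] by (simp add: w_def power2_eq_square)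
      finally show ?thesis .
    qed
    then have "integral {0..1} (\<lambda>t. W t \<bullet> vector [a, b, c])
        = integral {0..1} (\<lambda>t. r / R * (q t * n t)) + integral {0..1} (\<lambda>t::real. c\<^sup>2 / R)"
      by (simp only:) (intro Henstock_Kurzweil_Integration.integral_add integrable_continuous_real
          smooth_continuous_on smooths)
    also have "\<dots> = (r\<^sup>2 + c\<^sup>2) / R" by (simp add: qn power2_eq_square add_divide_distrib)
    also have "\<dots> = R" unfolding R(2)[symmetric] using R(1) by (simp add: power2_eq_square)
    finally show ?thesis .
  qed
  finally show ?thesis unfolding R_def .
qed

theorem theorem4p1:
  fixes lam :: real and q :: "real \<Rightarrow> real"
  assumes "lam > 1"
    and "smooth q"
    and "\<And>t. q (t + 1) = q t"
    and "\<And>t. q t > 0"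
    and "\<And>t. q t + q (t + 1/2) = 2 / kappa lam"
  shows "riemannian_metric (g_metric lam q)
    \<and> \<not> flat (g_metric lam q)
    \<and> (\<forall>a b c. stable_norm (g_metric lam q) (r_class a b c) = ereal (sqrt (a^2 + b^2 + c^2)))
    \<and> riem_volume (g_metric lam q) = 1 / kappa lam"
proof (intro conjI allI)
  have lam: "lam > 0" using assms(1) by simp
  show "riemannian_metric (g_metric lam q)" by (rule riemannian_g_metric[of lam q, OF lam assms(2-4)])
  show "\<not> flat (g_metric lam q)" by (rule not_flat_g_metric[of lam q, OF assms(1,2,4)])
  show "stable_norm (g_metric lam q) (r_class a b c) = ereal (sqrt (a^2 + b^2 + c^2))" for a b c
  proof (cases "a = 0 \<and> b = 0")
    case True
    then show ?thesis using stable_norm_g_metric_vertical[of lam q, OF lam assms(2,4)] by simp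
  next
    case False
    then have "a\<^sup>2 + b\<^sup>2 > 0" by (simp add: sum_power2_gt_zero_iff)
    then show ?thesis by (rule stable_norm_g_metric_oblique[of lam q, OF lam assms(2-5)])
  qed
  have "sqrt (det (g_metric lam q p)) = q (p $ 3)" for p
    using assms(4)[of "p $ 3"] by (simp add: det_g_metric[OF lam])
  then have "riem_volume (g_metric lam q) = integral {0..1} q"
    by (simp add: riem_volume_def torus_integral_lift[of q, OF assms(2,3)])
  also have "\<dots> = 1 / kappa lam"
    using integral_half_period_average[OF smooth_continuous_on[OF assms(2)] assms(3)
        continuous_on_const[of _ 1] _ assms(5)] by simp
  finally show "riem_volume (g_metric lam q) = 1 / kappa lam" .
qed

end
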